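(* Let $m\ge 1$ be an odd integer, let $k,l\ge 0$ be integers, and let $P_{k,l}(\underline x,\underline y)$ be an $\mathbb R_{0,m}$-valued homogeneous biregular polynomial in $\mathbb R^m\times\mathbb R^m$ of degree $k$ in $\underline x$ and degree $l$ in $\underline y$. Let $\Xi$ be an open subset of $\{(x_1,y_1,x_2,y_2)\in\mathbb R^2\times\mathbb R^2:\ y_1>0,\ y_2>0\}$ and let $u_1,v_1,u_2,v_2:\Xi\to\mathbb R$ be $C^1$ functions of $(x_1,y_1,x_2,y_2)$ satisfying in $\Xi$ the Cauchy-Riemann systems $$\partial_{x_1}u_1=\partial_{y_1}v_1,\quad \partial_{y_1}u_1=-\partial_{x_1}v_1,\qquad \partial_{x_1}u_2=\partial_{y_1}v_2,\quad \partial_{y_1}u_2=-\partial_{x_1}v_2,$$ $$\partial_{x_2}u_1=\partial_{y_2}u_2,\quad \partial_{y_2}u_1=-\partial_{x_2}u_2,\qquad \partial_{x_2}v_1=\partial_{y_2}v_2,\quad \partial_{y_2}v_1=-\partial_{x_2}v_2.$$ Then the function $$\Delta_x^{k+\frac{m-1}{2}}\Delta_y^{l+\frac{m-1}{2}}\Bigl(u_1(x_0,r,y_0,\rho)P_{k,l}(\underline x,\underline y)+v_1(x_0,r,y_0,\rho)\,\underline\omega\,P_{k,l}(\underline x,\underline y)+u_2(x_0,r,y_0,\rho)P_{k,l}(\underline x,\underline y)\,\underline\nu+v_2(x_0,r,y_0,\rho)\,\underline\omega\,P_{k,l}(\underline x,\underline y)\,\underline\nu\Bigr)$$ is biregular in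 $\Omega=\{(x,y)\in\mathbb R^{m+1}\times\mathbb R^{m+1}:\ (x_0,r,y_0,\rho)\in\Xi\}$.
   Context: $\mathbb R_{0,m}$ is the $2^m$-dimensional real Clifford algebra generated by the standard basis $e_1,\dots,e_m$ of $\mathbb R^m$ with relations $e_je_k+e_ke_j=-2\delta_{jk}$, $j,k=1,\dots,m$. Points of $\mathbb R^{m+1}\times\mathbb R^{m+1}$ are written $(x,y)=(x_0,\dots,x_m,y_0,\dots,y_m)$, with $\underline x=\sum_{j=1}^m x_je_j$, $\underline y=\sum_{j=1}^m y_je_j$, identified with vectors in $\mathbb R^m$, and $x=x_0+\underline x$, $y=y_0+\underline y$. Put $r=|\underline x|$, $\rho=|\underline y|$ (Euclidean norms), $\underline\omega=\underline x/r$, $\underline\nu=\underline y/\rho$. Operators: $\partial_{\underline x}=\sum_{j=1}^m e_j\partial_{x_j}$, $\partial_x=\partial_{x_0}+\partial_{\underline x}$, $\partial_{\underline y}=\sum_{j=1}^m e_j\partial_{y_j}$, $\partial_y=\partial_{y_0}+\partial_{\underline y}$, $\Delta_x=\sum_{j=0}^m\partial_{x_j}^2$, $\Delta_y=\sum_{j=0}^m\partial_{y_j}^2$. For an $\mathbb R_{0,m}$-valued $C^1$ function $f$, $\partial_x f=\partial_{x_0}f+\sum_{j=1}^m e_j(\partial_{x_j}f)$ (Clifford multiplication from the left) and $f\partial_y=\partial_{y_0}f+\sum_{j=1}^m(\partial_{y_j}f)e_j$ (Clifford multiplication from the right); likewise $\partial_{\underline x}f$ and $f\partial_{\underline y}$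 without the $x_0$, $y_0$ terms. A $C^1$ function $f:\Omega\to\mathbb R_{0,m}$ on an open set $\Omega\subset\mathbb R^{m+1}\times\mathbb R^{m+1}$ is biregular in $\Omega$ if $\partial_xf=0$ and $f\partial_y=0$ in $\Omega$. A homogeneous biregular polynomial $P_{k,l}(\underline x,\underline y)$ in $\mathbb R^m\times\mathbb R^m$ of degree $k$ in $\underline x$ and $l$ in $\underline y$ is an $\mathbb R_{0,m}$-valued polynomial in $x_1,\dots,x_m,y_1,\dots,y_m$ such that $\partial_{\underline x}P_{k,l}=P_{k,l}\partial_{\underline y}=0$ on $\mathbb R^m\times\mathbb R^m$ and $P_{k,l}(t_1\underline x,t_2\underline y)=t_1^kt_2^lP_{k,l}(\underline x,\underline y)$ for all $t_1,t_2\in\mathbb R$. *)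

theory Defs
  imports "HOL-Analysis.Analysis"
begin

(* The Clifford algebra R_{0,m}, m = CARD('m), in coordinates: the coordinate with index
   A = {j_1 < ... < j_s} belongs to the basis blade e_A = e_{j_1} ... e_{j_s}. *)
type_synonym 'm clifford = "(real, 'm set) vec"

definition blade :: "'m::finite set \<Rightarrow> 'm clifford" where
  "blade A = axis A 1"

(* e_A e_B = clsign A B * e_{sym_diff A B}: each pair b < a in A x B costs one transposition,
   each common index a = b contributes e_a^2 = -1. *)
definition clsign :: "'m::{finite,linorder} set \<Rightarrow> 'm set \<Rightarrow> real" where
  "clsign A B = (\<Prod>a\<in>A. \<Prod>b\<in>B. if b \<le> a then - 1 else 1)"

definition clmult :: "'m::{finite,linorder} clifford \<Rightarrow> 'm clifford \<Rightarrow> 'm clifford"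
    (infixl "\<odot>" 70) where
  "f \<odot> g = (\<Sum>A\<in>UNIV. \<Sum>B\<in>UNIV. (f $ A * g $ B * clsign A B) *\<^sub>R blade (sym_diff A B))"

definition gen :: "'m::finite \<Rightarrow> 'm clifford" where
  "gen j = blade {j}"

definition clvec :: "real ^ 'm \<Rightarrow> 'm::finite clifford" where
  "clvec x = (\<Sum>j\<in>UNIV. (x $ j) *\<^sub>R gen j)"

(* The following facts show that clmult is the product of R_{0,m}. *)

lemma bilinear_clmult: "bilinear (\<odot>)"
  unfolding bilinear_def clmult_def
  by (auto intro!: linearI simp: algebra_simps sum.distrib scaleR_sum_right)

lemma blade_mult: "blade A \<odot> blade B = clsign A B *\<^sub>R blade (sym_diff A B)"
proof -
  have "blade A \<odot> blade B =
      (\<Sum>A'\<in>UNIV. if A' = A then (\<Sum>B'\<in>UNIV. if B' = B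
         then clsign A' B' *\<^sub>R blade (sym_diff A' B') else 0) else 0)"
    unfolding clmult_def
  proof (intro sum.cong refl)
    fix A' :: "'a set"
    have "((blade A :: 'a clifford) $ A' * (blade B :: 'a clifford) $ B' * clsign A' B')
             *\<^sub>R blade (sym_diff A' B') =
          (if A' = A then if B' = B then clsign A' B' *\<^sub>R blade (sym_diff A' B') else 0 else 0)" for B'
      by (simp add: blade_def[of A] blade_def[of B] axis_def)
    then show "(\<Sum>B'\<in>UNIV. ((blade A :: 'a clifford) $ A' * (blade B :: 'a clifford) $ B' * clsign A' B')
             *\<^sub>R blade (sym_diff A' B')) =
          (if A' = A then \<Sum>B'\<in>UNIV. if B' = B then clsign A' B' *\<^sub>R blade (sym_diff A' B') else 0 else 0)"
      by simp
  qed
  then show ?thesis by simp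
qed

lemma clifford_expand: "f = (\<Sum>A\<in>UNIV. (f $ A) *\<^sub>R blade A)"
  by (simp add: vec_eq_iff blade_def axis_def if_distrib cong: if_cong)

lemma prod_sym_diff:
  fixes h :: "'a::finite \<Rightarrow> real"
  assumes "\<And>a. h a * h a = 1"
  shows "prod h (sym_diff A B) = prod h A * prod h B"
proof -
  have A: "prod h A = prod h (A - B) * prod h (A \<inter> B)"
    by (subst prod.union_disjoint[symmetric]) (auto intro!: prod.cong)
  have B: "prod h B = prod h (B - A) * prod h (A \<inter> B)"
    by (subst prod.union_disjoint[symmetric]) (auto intro!: prod.cong)
  have "prod h (A \<inter> B) * prod h (A \<inter> B) = 1"
    by (simp add: prod.distrib[symmetric] assms)
  moreover have "prod h (sym_diff A B) = prod h (A - B) * prod h (B - A)"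
    by (rule prod.union_disjoint) auto
  ultimately show ?thesis unfolding A B by (simp add: algebra_simps)
qed

lemma clsign_sym_diff:
  "clsign (sym_diff A B) C = clsign A C * clsign B C"
  "clsign A (sym_diff B C) = clsign A B * clsign A C"
proof -
  show "clsign (sym_diff A B) C = clsign A C * clsign B C"
    unfolding clsign_def by (rule prod_sym_diff) (auto simp: prod.distrib[symmetric] intro!: prod.neutral)
  have "(\<Prod>b\<in>sym_diff B C. if b \<le> a then - 1 else 1) =
      (\<Prod>b\<in>B. if b \<le> a then - 1 else 1) * (\<Prod>b\<in>C. if b \<le> a then - 1 else (1::real))" for a
    by (rule prod_sym_diff) simp
  then show "clsign A (sym_diff B C) = clsign A B * clsign A C"
    by (simp add: clsign_def prod.distrib)
qed

lemma clmult_assoc: "(f \<odot> g) \<odot> h = f \<odot> (g \<odot> h)"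
proof -
  have lin: "linear (\<lambda>x. x \<odot> y)" "linear (\<lambda>x. y \<odot> x)" for y
    using bilinear_clmult by (auto simp: bilinear_def)
  have blades: "(blade A \<odot> blade B) \<odot> blade C = blade A \<odot> (blade B \<odot> blade C)"
    for A B C :: "'a set"
  proof -
    have "sym_diff (sym_diff A B) C = sym_diff A (sym_diff B C)" by blast
    then show ?thesis
      by (simp add: blade_mult linear_cmul[OF lin(1)] linear_cmul[OF lin(2)] clsign_sym_diff
          mult.commute mult.left_commute)
  qed
  have "(blade A \<odot> blade B) \<odot> h = blade A \<odot> (blade B \<odot> h)" for A B
    by (subst (1 2) clifford_expand[of h])
      (simp add: linear_sum[OF lin(2)] linear_cmul[OF lin(2)] blades)
  then have "(blade A \<odot> g) \<odot> h = blade A \<odot> (g \<odot> h)" for A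
    by (subst (1 2) clifford_expand[of g])
      (simp add: linear_sum[OF lin(1)] linear_cmul[OF lin(1)]
         linear_sum[OF lin(2)] linear_cmul[OF lin(2)])
  then show ?thesis
    by (subst (1 2) clifford_expand[of f])
      (simp add: linear_sum[OF lin(1)] linear_cmul[OF lin(1)])
qed

lemma clmult_one: "blade {} \<odot> f = f" "f \<odot> blade {} = f"
proof -
  have lin: "linear (\<lambda>x. x \<odot> y)" "linear (\<lambda>x. y \<odot> x)" for y :: "'a clifford"
    using bilinear_clmult by (auto simp: bilinear_def)
  have b: "blade {} \<odot> blade A = blade A" "blade A \<odot> blade {} = blade A" for A :: "'a set"
    by (simp_all add: blade_mult clsign_def)
  show "blade {} \<odot> f = f"
    by (subst (1 2) clifford_expand[of f])
      (simp only: linear_sum[OF lin(2)] linear_cmul[OF lin(2)] b)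
  show "f \<odot> blade {} = f"
    by (subst (1 2) clifford_expand[of f])
      (simp only: linear_sum[OF lin(1)] linear_cmul[OF lin(1)] b)
qed

lemma gen_anticommute:
  "gen j \<odot> gen k + gen k \<odot> gen j = (if j = k then - 2 else 0) *\<^sub>R blade {}"
proof (cases "j = k")
  case True
  then show ?thesis by (simp add: gen_def blade_mult clsign_def scaleR_2[symmetric])
next
  case False
  then have "sym_diff {j} {k} = {j, k}" "sym_diff {k} {j} = {j, k}" by auto
  with False show ?thesis by (auto simp: gen_def blade_mult clsign_def)
qed

lemma blade_insert:
  assumes "\<forall>a\<in>A. j < a"
  shows "blade (insert j A) = gen j \<odot> blade A"
proof -
  have "sym_diff {j} A = insert j A" "clsign {j} A = 1"
    using assms by (auto simp: clsign_def intro!: prod.neutral)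
  then show ?thesis by (simp add: gen_def blade_mult)
qed

definition C1_on :: "('a::real_normed_vector \<Rightarrow> 'b::real_normed_vector) \<Rightarrow> 'a set \<Rightarrow> bool" where
  "C1_on f S \<longleftrightarrow> (\<exists>f' :: 'a \<Rightarrow> 'a \<Rightarrow>\<^sub>L 'b.
     (\<forall>p\<in>S. (f has_derivative blinfun_apply (f' p)) (at p)) \<and> continuous_on S f')"

(* Partial derivatives are the directional derivatives along the standard basis vectors. *)
definition pd :: "'a::real_normed_vector \<Rightarrow> ('a \<Rightarrow> 'b::real_normed_vector) \<Rightarrow> 'a \<Rightarrow> 'b" where
  "pd v f p = vector_derivative (\<lambda>t. f (p + t *\<^sub>R v)) (at 0)"

(* ((x0, x), (y0, y)) with x0, y0 the scalar and x, y the vector parts *)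
type_synonym 'm point = "(real \<times> (real, 'm) vec) \<times> (real \<times> (real, 'm) vec)"

definition dirac_x :: "('m::{finite,linorder} point \<Rightarrow> 'm clifford) \<Rightarrow> 'm point \<Rightarrow> 'm clifford" where
  "dirac_x f p = pd ((1, 0), (0, 0)) f p
     + (\<Sum>j\<in>UNIV. gen j \<odot> pd ((0, axis j 1), (0, 0)) f p)"

definition dirac_y :: "('m::{finite,linorder} point \<Rightarrow> 'm clifford) \<Rightarrow> 'm point \<Rightarrow> 'm clifford" where
  "dirac_y f p = pd ((0, 0), (1, 0)) f p
     + (\<Sum>j\<in>UNIV. pd ((0, 0), (0, axis j 1)) f p \<odot> gen j)"

definition laplace_x :: "('m::finite point \<Rightarrow> 'm clifford) \<Rightarrow> 'm point \<Rightarrow> 'm clifford" where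
  "laplace_x f p = pd ((1, 0), (0, 0)) (pd ((1, 0), (0, 0)) f) p
     + (\<Sum>j\<in>UNIV. pd ((0, axis j 1), (0, 0)) (pd ((0, axis j 1), (0, 0)) f) p)"

definition laplace_y :: "('m::finite point \<Rightarrow> 'm clifford) \<Rightarrow> 'm point \<Rightarrow> 'm clifford" where
  "laplace_y f p = pd ((0, 0), (1, 0)) (pd ((0, 0), (1, 0)) f) p
     + (\<Sum>j\<in>UNIV. pd ((0, 0), (0, axis j 1)) (pd ((0, 0), (0, axis j 1)) f) p)"

definition biregular_on :: "('m::{finite,linorder} point \<Rightarrow> 'm clifford) \<Rightarrow> 'm point set \<Rightarrow> bool" where
  "biregular_on f \<Omega> \<longleftrightarrow> open \<Omega> \<and> C1_on f \<Omega> \<and> (\<forall>p\<in>\<Omega>. dirac_x f p = 0 \<and> dirac_y f p = 0)"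

definition homogeneous_biregular_polynomial ::
  "nat \<Rightarrow> nat \<Rightarrow> ((real, 'm) vec \<times> (real, 'm) vec \<Rightarrow> 'm::{finite,linorder} clifford) \<Rightarrow> bool" where
  "homogeneous_biregular_polynomial k l P \<longleftrightarrow>
     polynomial_function P \<and>
     (\<forall>p. (\<Sum>j\<in>UNIV. gen j \<odot> pd (axis j 1, 0) P p) = 0) \<and>
     (\<forall>p. (\<Sum>j\<in>UNIV. pd (0, axis j 1) P p \<odot> gen j) = 0) \<and>
     (\<forall>t1 t2 x y. P (t1 *\<^sub>R x, t2 *\<^sub>R y) = (t1 ^ k * t2 ^ l) *\<^sub>R P (x, y))"

(* points (x1, y1, x2, y2) grouped as ((x1, y1), (x2, y2)) *)
type_synonym plane2 = "(real \<times> real) \<times> (real \<times> real)"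

definition cauchy_riemann_1 :: "(plane2 \<Rightarrow> real) \<Rightarrow> (plane2 \<Rightarrow> real) \<Rightarrow> plane2 set \<Rightarrow> bool" where
  "cauchy_riemann_1 u v S \<longleftrightarrow> (\<forall>p\<in>S.
     pd ((1, 0), (0, 0)) u p = pd ((0, 1), (0, 0)) v p \<and>
     pd ((0, 1), (0, 0)) u p = - pd ((1, 0), (0, 0)) v p)"

definition cauchy_riemann_2 :: "(plane2 \<Rightarrow> real) \<Rightarrow> (plane2 \<Rightarrow> real) \<Rightarrow> plane2 set \<Rightarrow> bool" where
  "cauchy_riemann_2 u v S \<longleftrightarrow> (\<forall>p\<in>S.
     pd ((0, 0), (1, 0)) u p = pd ((0, 0), (0, 1)) v p \<and>
     pd ((0, 0), (0, 1)) u p = - pd ((0, 0), (1, 0)) v p)"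

end

theory Submission
  imports Defs "HOL-Complex_Analysis.Cauchy_Integral_Formula"
begin

text \<open>
  The theorem is Fueter's theorem applied once in x and once in y; the two applications do not
  interfere, because operators with constant coefficients commute on smooth functions.

  Let m be the dimension, F the function to which the Laplacians are applied, r = |x| for the vector
  part x, and n = k + (m-1)/2. Since the Dirac operator D_x commutes with both Laplacians, left
  regularity follows from \<Delta>_x^n D_x F = 0, and this concerns only the restrictions of F to the slices with
  fixed y. On such a slice F = (u1 + v1 \<omega>) Q + (u2 + v2 \<omega>) Q', where Q = P(\<cdot>, y) and Q' = Q \<nu> are both
  monogenic and homogeneous of degree k. The Cauchy-Riemann equations give
  D_x ((u + v \<omega>) Q) = -(2k+m-1) (v/r) Q (lemma dirac_axial), and for a function g of (x0, r) one has
  \<Delta>_x (g Q) = (L_c g) Q with c = 2k+m-1 and L_c = \<partial>_0^2 + \<partial>_r^2 + (c/r) \<partial>_r (lemma laplacian_axial).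

  It remains to see that the n-th power of L_c annihilates n v/r; here c = 2n because m is odd. The
  functions g_0 = v/r and g_(j+1) = (1/r) \<partial>_r g_j satisfy L_(2(j+1)) g_j = 0: for j = 0 this is the
  harmonicity of v, and the relation L_(c+2) (1/r) \<partial>_r = (1/r) \<partial>_r L_c does the induction (lemma
  radial_op_iter). Hence L_(2n) g_j = (2n - 2(j+1)) g_(j+1), and the factors 2n, 2n-2, ..., 0 collected
  in this way have product zero (theorem fueter_one_variable).

  The same statement serves both sides: Fueter's theorem is proved for functions with values in a
  space on which the generators act by anticommuting operators with square -1. Left multiplication
  by the generators is one such action and right multiplication another; between the two, v1 and u2
  exchange their roles.

  The Laplacians differentiate functions that are given as C^1 only. That all derivatives exist is
  Osgood's theorem: (u1 - v2) + i (v1 + u2) is separately holomorphic, (u1 + v2) + i (v1 - u2)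
  becomes so after conjugating the second complex variable, and the class of continuous separately
  holomorphic functions is closed under both complex partial derivatives by Cauchy's integral
  formula (lemmas separately_holomorphic_deriv_fst and bicomplex_Cauchy_Riemann_smooth).
\<close>


section \<open>Directional derivatives and smooth functions\<close>

text \<open>
  A restriction to a line is awkward for sum and product rules; for differentiable functions all
  rules below come from the corresponding rule for the total derivative.
\<close>
lemma has_derivative_imp_pd:
  assumes "(f has_derivative f') (at p)"
  shows "pd v f p = f' v"
proof -
  interpret f': bounded_linear f' by (rule has_derivative_bounded_linear[OF assms])
  have "((\<lambda>t. p + t *\<^sub>R v) has_derivative (\<lambda>t. t *\<^sub>R v)) (at 0)"
    by (auto intro!: derivative_eq_intros)
  from diff_chain_at[OF this, of f f'] assms
  have "((\<lambda>t. f (p + t *\<^sub>R v)) has_derivative (\<lambda>t. f' (t *\<^sub>R v))) (at 0)"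
    by (simp add: o_def)
  then have "((\<lambda>t. f (p + t *\<^sub>R v)) has_vector_derivative f' v) (at 0)"
    by (simp add: has_vector_derivative_def f'.scaleR)
  then show ?thesis unfolding pd_def by (rule vector_derivative_at)
qed

lemma has_derivative_pd:
  assumes "f differentiable (at p)"
  shows "(f has_derivative (\<lambda>v. pd v f p)) (at p)"
  using assms has_derivative_imp_pd unfolding differentiable_def by (metis ext)

text \<open>
  Identities between the functions below hold on open sets only; locality allows rewriting with them
  inside a derivative.
\<close>
lemma pd_cong_open:
  assumes "open S" "p \<in> S" "\<And>q. q \<in> S \<Longrightarrow> f q = g q"
  shows "pd v f p = pd v g p"
proof -
  have "((\<lambda>t. p + t *\<^sub>R v) \<longlongrightarrow> p + 0 *\<^sub>R v) (at (0::real))"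
    by (intro tendsto_intros)
  with assms(1,2) have "\<forall>\<^sub>F t in at (0::real). p + t *\<^sub>R v \<in> S"
    by (intro topological_tendstoD) auto
  then have "\<forall>\<^sub>F t in nhds (0::real). p + t *\<^sub>R v \<in> S"
    using assms(2) by (simp add: eventually_nhds_conv_at)
  then have "\<forall>\<^sub>F t in nhds (0::real). t \<in> UNIV \<longrightarrow> f (p + t *\<^sub>R v) = g (p + t *\<^sub>R v)"
    by eventually_elim (use assms(3) in auto)
  then show ?thesis unfolding pd_def
    by (intro vector_derivative_cong_eq) auto
qed

lemma pd_const [simp]: "pd v (\<lambda>x. c) p = 0"
  by (simp add: pd_def)

lemma pd_bounded_linear: "bounded_linear A \<Longrightarrow> pd v A p = A v"
  by (rule has_derivative_imp_pd) (rule bounded_linear_imp_has_derivative)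

lemma pd_bounded_linear_comp:
  assumes "bounded_linear A" "f differentiable (at p)"
  shows "pd v (\<lambda>x. A (f x)) p = A (pd v f p)"
  by (rule has_derivative_imp_pd[OF bounded_linear.has_derivative[OF assms(1)
        has_derivative_pd[OF assms(2)]]])

lemma pd_add:
  assumes "f differentiable (at p)" "g differentiable (at p)"
  shows "pd v (\<lambda>x. f x + g x) p = pd v f p + pd v g p"
  by (rule has_derivative_imp_pd[OF has_derivative_add[OF assms[THEN has_derivative_pd]]])

lemma pd_diff:
  assumes "f differentiable (at p)" "g differentiable (at p)"
  shows "pd v (\<lambda>x. f x - g x) p = pd v f p - pd v g p"
  by (rule has_derivative_imp_pd[OF has_derivative_diff[OF assms[THEN has_derivative_pd]]])

lemma pd_sum:
  assumes "\<And>i. i \<in> I \<Longrightarrow> f i differentiable (at p)"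
  shows "pd v (\<lambda>x. \<Sum>i\<in>I. f i x) p = (\<Sum>i\<in>I. pd v (f i) p)"
  by (rule has_derivative_imp_pd[OF has_derivative_sum[OF assms[THEN has_derivative_pd]]])

lemma pd_bilinear:
  assumes "bounded_bilinear B" "f differentiable (at p)" "g differentiable (at p)"
  shows "pd v (\<lambda>x. B (f x) (g x)) p = B (pd v f p) (g p) + B (f p) (pd v g p)"
  by (subst has_derivative_imp_pd[OF bounded_bilinear.FDERIV[OF assms(1)
        assms(2,3)[THEN has_derivative_pd]]]) (simp add: add.commute)

lemma pd_scaleR:
  assumes "f differentiable (at p)" "g differentiable (at p)"
  shows "pd v (\<lambda>x. f x *\<^sub>R g x) p = pd v f p *\<^sub>R g p + f p *\<^sub>R pd v g p"
  by (rule pd_bilinear[OF bounded_bilinear_scaleR assms])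

lemma pd_chain:
  assumes "f differentiable (at p)" "g differentiable (at (f p))"
  shows "pd v (\<lambda>x. g (f x)) p = pd (pd v f p) g (f p)"
  using has_derivative_imp_pd[OF diff_chain_at[OF assms[THEN has_derivative_pd]], of v]
  by (simp add: o_def)

lemma linear_pd:
  assumes "f differentiable (at p)"
  shows "linear (\<lambda>v. pd v f p)"
  using has_derivative_pd[OF assms] by (simp add: has_derivative_linear)

lemma pd_basis_expansion:
  fixes f :: "'a::euclidean_space \<Rightarrow> 'b::real_normed_vector"
  assumes "f differentiable (at p)"
  shows "pd v f p = (\<Sum>b\<in>Basis. (v \<bullet> b) *\<^sub>R pd b f p)"
proof -
  have "pd v f p = pd (\<Sum>b\<in>Basis. (v \<bullet> b) *\<^sub>R b) f p"
    by (simp add: euclidean_representation)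
  then show ?thesis
    by (simp add: linear_sum[OF linear_pd[OF assms]] linear_cmul[OF linear_pd[OF assms]])
qed


text \<open>
  On open subsets of finite dimensional spaces this is the class C^n. The recursion runs through
  directional derivatives, instead of multilinear higher derivatives, because the operators of the
  theorem are composed of them.
\<close>
primrec Ck_on :: "nat \<Rightarrow> ('a::real_normed_vector \<Rightarrow> 'b::real_normed_vector) \<Rightarrow> 'a set \<Rightarrow> bool" where
  "Ck_on 0 f S \<longleftrightarrow> continuous_on S f"
| "Ck_on (Suc n) f S \<longleftrightarrow> (\<forall>p\<in>S. f differentiable (at p)) \<and> (\<forall>v. Ck_on n (pd v f) S)"

lemma Ck_on_cong:
  assumes "open S" "\<And>p. p \<in> S \<Longrightarrow> f p = g p" "Ck_on n f S"
  shows "Ck_on n g S"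
  using assms(2,3)
proof (induction n arbitrary: f g)
  case 0
  then show ?case using continuous_on_cong[of S S f g] by simp
next
  case (Suc n)
  have "g differentiable (at p)" if p: "p \<in> S" for p
  proof -
    have "f differentiable (at p)" using Suc.prems(2) p by simp
    then obtain D where "(f has_derivative D) (at p)" unfolding differentiable_def ..
    then have "(g has_derivative D) (at p)"
      by (rule has_derivative_transform_within_open[where f=f, OF _ \<open>open S\<close> p]) (rule Suc.prems(1))
    then show ?thesis by (rule differentiableI)
  qed
  moreover have "Ck_on n (pd v g) S" for v
  proof (rule Suc.IH[of "pd v f"])
    show "pd v f p = pd v g p" if "p \<in> S" for p
      using pd_cong_open[OF \<open>open S\<close> that Suc.prems(1)] .
    show "Ck_on n (pd v f) S" using Suc.prems(2) by simp
  qed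
  ultimately show ?case by simp
qed

lemma Ck_on_Suc_imp: "Ck_on (Suc n) f S \<Longrightarrow> Ck_on n f S"
proof (induction n arbitrary: f)
  case 0
  then show ?case
    by (auto intro!: continuous_at_imp_continuous_on differentiable_imp_continuous_within)
next
  case (Suc n)
  then show ?case by (metis Ck_on.simps(2))
qed

lemma Ck_on_const: "Ck_on n (\<lambda>x. c) S"
proof (induction n arbitrary: c)
  case (Suc n)
  have "pd v (\<lambda>x::'a. c) = (\<lambda>x. 0)" for v by auto
  with Suc show ?case by simp
qed simp

lemma Ck_on_bounded_linear:
  assumes "bounded_linear A"
  shows "Ck_on n A S"
proof (cases n)
  case 0
  then show ?thesis using assms by (simp add: linear_continuous_on)
next
  case (Suc k)
  have "pd v A = (\<lambda>x. A v)" for v using assms by (auto simp: pd_bounded_linear)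
  with Suc assms show ?thesis by (simp add: Ck_on_const bounded_linear_imp_differentiable)
qed

lemma Ck_on_add:
  assumes "open S" "Ck_on n f S" "Ck_on n g S"
  shows "Ck_on n (\<lambda>x. f x + g x) S"
  using assms(2,3)
proof (induction n arbitrary: f g)
  case 0
  then show ?case by (auto intro: continuous_intros)
next
  case (Suc n)
  have "Ck_on n (pd v (\<lambda>x. f x + g x)) S" for v
    by (rule Ck_on_cong[OF \<open>open S\<close> _ Suc.IH[of "pd v f" "pd v g"]])
      (use Suc.prems in \<open>simp_all add: pd_add\<close>)
  with Suc.prems show ?case by simp
qed

lemma Ck_on_sum:
  assumes "open S" "\<And>i. i \<in> I \<Longrightarrow> Ck_on n (f i) S"
  shows "Ck_on n (\<lambda>x. \<Sum>i\<in>I. f i x) S"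
  using assms(2)
  by (induction I rule: infinite_finite_induct) (auto simp: Ck_on_const intro: Ck_on_add[OF \<open>open S\<close>])

text \<open>
  The product rule expresses a derivative of the product by two products of the same kind; in each,
  one factor is differentiated and the other one loses an order of differentiability.
\<close>
lemma Ck_on_bilinear:
  assumes "open S" "bounded_bilinear B" "Ck_on n f S" "Ck_on n g S"
  shows "Ck_on n (\<lambda>x. B (f x) (g x)) S"
  using assms(3,4)
proof (induction n arbitrary: f g)
  case 0
  then show ?case using assms(2) by (simp add: bounded_bilinear.continuous_on)
next
  case (Suc n)
  have "Ck_on n (pd v (\<lambda>x. B (f x) (g x))) S" for v
  proof (rule Ck_on_cong[OF \<open>open S\<close>])
    show "Ck_on n (\<lambda>x. B (pd v f x) (g x) + B (f x) (pd v g x)) S"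
      using Suc.prems
      by (intro Ck_on_add[OF \<open>open S\<close>] Suc.IH Suc.prems[THEN Ck_on_Suc_imp]) simp_all
  qed (use Suc.prems in \<open>auto simp: pd_bilinear[OF assms(2)]\<close>)
  moreover have "(\<lambda>x. B (f x) (g x)) differentiable (at p)" if "p \<in> S" for p
    using Suc.prems that bounded_bilinear.FDERIV[OF assms(2)] unfolding differentiable_def
    by (metis Ck_on.simps(2) differentiable_def)
  ultimately show ?case by simp
qed

text \<open>
  The inner function takes values in a finite dimensional space so that the chain rule becomes a
  finite sum of products of partial derivatives, to which the induction hypothesis applies.
\<close>
lemma Ck_on_compose:
  fixes f :: "'a::real_normed_vector \<Rightarrow> 'b::euclidean_space"
  assumes "open S" "Ck_on n f S" "Ck_on n g T" "f ` S \<subseteq> T"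
  shows "Ck_on n (\<lambda>x. g (f x)) S"
  using assms(2,3)
proof (induction n arbitrary: g)
  case 0
  then show ?case using \<open>f ` S \<subseteq> T\<close> by (auto intro: continuous_on_compose2)
next
  case (Suc n)
  have diff: "f differentiable (at p)" "g differentiable (at (f p))" if "p \<in> S" for p
    using Suc.prems assms(4) that by auto
  have "Ck_on n (pd v (\<lambda>x. g (f x))) S" for v
  proof (rule Ck_on_cong[OF \<open>open S\<close>])
    show "Ck_on n (\<lambda>x. \<Sum>b\<in>Basis. (pd v f x \<bullet> b) *\<^sub>R pd b g (f x)) S"
      using Suc.prems
      by (intro Ck_on_sum Ck_on_bilinear[OF _ bounded_bilinear_scaleR] Suc.IH
          Ck_on_bilinear[OF _ bounded_bilinear_inner] Ck_on_const Ck_on_Suc_imp[of n f] \<open>open S\<close>) auto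
  qed (simp add: pd_chain[OF diff] pd_basis_expansion[OF diff(2)])
  moreover have "(\<lambda>x. g (f x)) differentiable (at p)" if "p \<in> S" for p
    using differentiable_chain_at[OF diff[OF that]] by (simp add: o_def)
  ultimately show ?case by simp
qed


definition smooth_on :: "('a::real_normed_vector \<Rightarrow> 'b::real_normed_vector) \<Rightarrow> 'a set \<Rightarrow> bool" where
  "smooth_on f S \<longleftrightarrow> open S \<and> (\<forall>n. Ck_on n f S)"

lemma smooth_on_open: "smooth_on f S \<Longrightarrow> open S"
  by (simp add: smooth_on_def)

lemma smooth_on_differentiable: "smooth_on f S \<Longrightarrow> p \<in> S \<Longrightarrow> f differentiable (at p)"
  unfolding smooth_on_def by (metis Ck_on.simps(2))

lemma smooth_on_continuous: "smooth_on f S \<Longrightarrow> continuous_on S f"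
  unfolding smooth_on_def by (metis Ck_on.simps(1))

lemma smooth_on_cong:
  "smooth_on f S \<Longrightarrow> (\<And>p. p \<in> S \<Longrightarrow> f p = g p) \<Longrightarrow> smooth_on g S"
  unfolding smooth_on_def using Ck_on_cong[of S f g] by auto

lemma smooth_on_pd: "smooth_on f S \<Longrightarrow> smooth_on (pd v f) S"
  unfolding smooth_on_def by (metis Ck_on.simps(2))

lemma smooth_on_const: "open S \<Longrightarrow> smooth_on (\<lambda>x. c) S"
  by (simp add: smooth_on_def Ck_on_const)

lemma smooth_on_bounded_linear: "bounded_linear A \<Longrightarrow> open S \<Longrightarrow> smooth_on A S"
  by (simp add: smooth_on_def Ck_on_bounded_linear)

lemma smooth_on_add:
  "smooth_on f S \<Longrightarrow> smooth_on g S \<Longrightarrow> smooth_on (\<lambda>x. f x + g x) S"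
  by (simp add: smooth_on_def Ck_on_add)

lemma smooth_on_sum:
  "open S \<Longrightarrow> (\<And>i. i \<in> I \<Longrightarrow> smooth_on (f i) S) \<Longrightarrow> smooth_on (\<lambda>x. \<Sum>i\<in>I. f i x) S"
  by (simp add: smooth_on_def Ck_on_sum)

lemma smooth_on_bilinear:
  "bounded_bilinear B \<Longrightarrow> smooth_on f S \<Longrightarrow> smooth_on g S \<Longrightarrow> smooth_on (\<lambda>x. B (f x) (g x)) S"
  by (simp add: smooth_on_def Ck_on_bilinear)

lemmas smooth_on_scaleR = smooth_on_bilinear[OF bounded_bilinear_scaleR]
lemmas smooth_on_mult =
  smooth_on_bilinear[OF bounded_bilinear_mult[where 'a=real]]

lemma smooth_on_compose:
  fixes f :: "'a::real_normed_vector \<Rightarrow> 'b::euclidean_space"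
  shows "smooth_on g T \<Longrightarrow> smooth_on f S \<Longrightarrow> f ` S \<subseteq> T \<Longrightarrow> smooth_on (\<lambda>x. g (f x)) S"
  using Ck_on_compose[of S _ f g T] by (simp add: smooth_on_def)

lemma smooth_on_bounded_linear_comp:
  assumes "bounded_linear A" "smooth_on f S"
  shows "smooth_on (\<lambda>x. A (f x)) S"
proof -
  have "Ck_on n (\<lambda>x. A (f x)) S" for n
    using assms(2)
  proof (induction n arbitrary: f)
    case 0
    then show ?case
      using assms(1) by (auto intro: smooth_on_continuous bounded_linear.continuous_on)
  next
    case (Suc n)
    have "Ck_on n (pd v (\<lambda>x. A (f x))) S" for v
      by (rule Ck_on_cong[OF smooth_on_open[OF Suc.prems] _ Suc.IH[OF smooth_on_pd[OF Suc.prems]]])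
        (use Suc.prems assms(1) in \<open>auto simp: pd_bounded_linear_comp smooth_on_differentiable\<close>)
    moreover have "(\<lambda>x. A (f x)) differentiable (at p)" if "p \<in> S" for p
      using that Suc.prems differentiable_chain_at[of f p A] assms(1)
      by (auto simp: o_def smooth_on_differentiable bounded_linear_imp_differentiable)
    ultimately show ?case by simp
  qed
  then show ?thesis using assms(2) by (simp add: smooth_on_def)
qed

lemma smooth_on_uminus: "smooth_on f S \<Longrightarrow> smooth_on (\<lambda>x. - f x) S"
  by (rule smooth_on_bounded_linear_comp[OF bounded_linear_minus[OF bounded_linear_ident]])

lemma smooth_on_Pair:
  assumes "smooth_on f S" "smooth_on g S"
  shows "smooth_on (\<lambda>x. (f x, g x)) S"
proof -
  have "smooth_on (\<lambda>x. (f x, 0) + (0, g x)) S"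
    using assms by (intro smooth_on_add smooth_on_bounded_linear_comp[of "\<lambda>y. (y, 0)"]
        smooth_on_bounded_linear_comp[of "\<lambda>y. (0, y)"])
      (auto intro: bounded_linear_Pair bounded_linear_zero bounded_linear_ident)
  then show ?thesis by simp
qed

lemma Ck_on_inverse: "Ck_on n (inverse :: real \<Rightarrow> real) (- {0})"
proof (induction n)
  case 0
  show ?case by (auto intro!: continuous_intros)
next
  case (Suc n)
  have *: "(inverse has_derivative (\<lambda>v. - (inverse p * v * inverse p))) (at p)" if "p \<noteq> 0" for p :: real
    using that by (rule has_derivative_inverse')
  have "Ck_on n (pd v (inverse :: real \<Rightarrow> real)) (- {0})" for v
  proof (rule Ck_on_cong)
    show "Ck_on n (\<lambda>p::real. (- v) * (inverse p * inverse p)) (- {0})"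
      by (intro Ck_on_bilinear[OF _ bounded_bilinear_mult] Ck_on_const Suc) auto
  qed (auto simp: has_derivative_imp_pd[OF *])
  with * show ?case by (auto simp: differentiable_def)
qed

lemma smooth_on_inverse:
  fixes f :: "'a::real_normed_vector \<Rightarrow> real"
  assumes "smooth_on f S" "\<And>p. p \<in> S \<Longrightarrow> f p \<noteq> 0"
  shows "smooth_on (\<lambda>x. inverse (f x)) S"
  by (rule smooth_on_compose[OF _ assms(1), of inverse "- {0}"])
    (use assms in \<open>auto simp: smooth_on_def Ck_on_inverse\<close>)

lemma smooth_on_divide:
  fixes f :: "'a::real_normed_vector \<Rightarrow> real"
  assumes "smooth_on f S" "smooth_on g S" "\<And>p. p \<in> S \<Longrightarrow> g p \<noteq> 0"
  shows "smooth_on (\<lambda>x. f x / g x) S"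
  unfolding divide_inverse by (intro smooth_on_mult smooth_on_inverse assms)

text \<open>
  The derivative in direction v is the linear function of p given by v times the inverse of the norm,
  so if the norm is C^n then its derivatives are C^n as well.
\<close>
lemma Ck_on_norm: "Ck_on n (norm :: 'a::euclidean_space \<Rightarrow> real) (- {0})"
proof (induction n)
  case 0
  show ?case by (auto intro!: continuous_intros)
next
  case (Suc n)
  have *: "(norm has_derivative (\<lambda>v. v \<bullet> sgn p)) (at p)" if "p \<noteq> 0" for p :: 'a
    using has_derivative_norm[OF that] by (simp add: inner_commute)
  have op: "open (- {0 :: 'a})" by auto
  have "Ck_on n (pd v (norm :: 'a \<Rightarrow> real)) (- {0})" for v
  proof (rule Ck_on_cong[OF op])
    show "Ck_on n (\<lambda>p::'a. (v \<bullet> p) * inverse (norm p)) (- {0})"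
      by (intro Ck_on_bilinear[OF op bounded_bilinear_mult] Ck_on_bilinear[OF op bounded_bilinear_inner]
          Ck_on_const Ck_on_compose[OF op Suc Ck_on_inverse] Ck_on_bounded_linear bounded_linear_ident) auto
  qed (auto simp: has_derivative_imp_pd[OF *] sgn_div_norm divide_inverse mult.commute)
  with * show ?case by (auto simp: differentiable_def)
qed

lemma smooth_on_norm:
  fixes f :: "'a::real_normed_vector \<Rightarrow> 'b::euclidean_space"
  assumes "smooth_on f S" "\<And>p. p \<in> S \<Longrightarrow> f p \<noteq> 0"
  shows "smooth_on (\<lambda>x. norm (f x)) S"
  by (rule smooth_on_compose[OF _ assms(1), of norm "- {0}"])
    (use assms in \<open>auto simp: smooth_on_def Ck_on_norm\<close>)

lemma smooth_on_polynomial_function: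
  fixes f :: "'a::real_normed_vector \<Rightarrow> 'b::euclidean_space"
  assumes "polynomial_function f" "open S"
  shows "smooth_on f S"
proof -
  have real: "smooth_on g S" if "real_polynomial_function g" for g :: "'a \<Rightarrow> real"
    using that
  proof (induction g)
    case (linear g)
    then show ?case using assms(2) by (rule smooth_on_bounded_linear)
  qed (simp_all add: smooth_on_const smooth_on_add smooth_on_mult assms(2))
  have "smooth_on (\<lambda>x. \<Sum>b\<in>Basis. (f x \<bullet> b) *\<^sub>R b) S"
  proof (rule smooth_on_sum[OF assms(2)], rule smooth_on_scaleR[OF _ smooth_on_const[OF assms(2)]])
    fix b :: 'b
    show "smooth_on (\<lambda>x. f x \<bullet> b) S"
      using assms(1) bounded_linear_inner_left[of b]
      by (intro real) (auto simp: polynomial_function_def o_def)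
  qed
  then show ?thesis by (simp add: euclidean_representation)
qed

lemma smooth_on_imp_C1_on:
  fixes f :: "'a::euclidean_space \<Rightarrow> 'b::real_normed_vector"
  assumes "smooth_on f S"
  shows "C1_on f S"
proof -
  define f' where "f' p = Blinfun (\<lambda>v. pd v f p)" for p
  have f': "blinfun_apply (f' p) = (\<lambda>v. pd v f p)" if "p \<in> S" for p
    using has_derivative_pd[OF smooth_on_differentiable[OF assms that]]
    by (simp add: f'_def bounded_linear_Blinfun_apply has_derivative_bounded_linear)
  have "continuous_on S (\<lambda>p. blinfun_apply (f' p) i)" for i
    by (subst continuous_on_cong[OF refl, of _ _ "pd i f"])
      (auto simp: f' smooth_on_continuous[OF smooth_on_pd[OF assms]])
  then have "continuous_on S f'" by (intro continuous_on_blinfun_componentwise)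
  moreover have "(f has_derivative blinfun_apply (f' p)) (at p)" if "p \<in> S" for p
    using has_derivative_pd[OF smooth_on_differentiable[OF assms that]] by (simp add: f' that)
  ultimately show ?thesis unfolding C1_on_def by blast
qed


text \<open>
  The left-hand side is symmetric in v and w, whereas the right-hand side contains the mixed
  derivative in one particular order; this is how the order of differentiation gets exchanged.
\<close>
lemma second_difference_mean_value:
  fixes f :: "'a::real_normed_vector \<Rightarrow> real"
  assumes "h > 0"
    and in_S: "\<And>s t. 0 \<le> s \<Longrightarrow> s \<le> h \<Longrightarrow> 0 \<le> t \<Longrightarrow> t \<le> h \<Longrightarrow> p + s *\<^sub>R v + t *\<^sub>R w \<in> S"
    and diff: "\<And>q. q \<in> S \<Longrightarrow> f differentiable (at q)" "\<And>q. q \<in> S \<Longrightarrow> pd v f differentiable (at q)"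
  obtains s t where "0 < s" "s < h" "0 < t" "t < h"
    "f (p + h *\<^sub>R v + h *\<^sub>R w) - f (p + h *\<^sub>R v) - f (p + h *\<^sub>R w) + f p
       = h\<^sup>2 * pd w (pd v f) (p + s *\<^sub>R v + t *\<^sub>R w)"
proof -
  have line: "((\<lambda>t. g (q + t *\<^sub>R z)) has_real_derivative pd z g (q + t *\<^sub>R z)) (at t)"
    if "g differentiable (at (q + t *\<^sub>R z))" for g :: "'a \<Rightarrow> real" and q z t
  proof -
    have "((\<lambda>t. q + t *\<^sub>R z) has_derivative (\<lambda>t. t *\<^sub>R z)) (at t)"
      by (auto intro!: derivative_eq_intros)
    from diff_chain_at[OF this has_derivative_pd[OF that]]
    show ?thesis unfolding has_field_derivative_def o_def
      by (rule has_derivative_eq_rhs) (simp add: fun_eq_iff linear_cmul[OF linear_pd[OF that]])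
  qed
  define \<phi> where "\<phi> s = f (p + h *\<^sub>R w + s *\<^sub>R v) - f (p + s *\<^sub>R v)" for s
  have "(\<phi> has_real_derivative pd v f (p + h *\<^sub>R w + s *\<^sub>R v) - pd v f (p + s *\<^sub>R v)) (at s)"
    if "0 \<le> s" "s \<le> h" for s
    unfolding \<phi>_def using in_S[OF that, of h] in_S[OF that, of 0] \<open>h > 0\<close>
    by (intro DERIV_diff line diff) (auto simp: algebra_simps)
  from MVT2[OF \<open>h > 0\<close> this] obtain s where s: "0 < s" "s < h"
    "\<phi> h - \<phi> 0 = h * (pd v f (p + h *\<^sub>R w + s *\<^sub>R v) - pd v f (p + s *\<^sub>R v))"
    by auto
  have "((\<lambda>t. pd v f (p + s *\<^sub>R v + t *\<^sub>R w)) has_real_derivative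
      pd w (pd v f) (p + s *\<^sub>R v + t *\<^sub>R w)) (at t)" if "0 \<le> t" "t \<le> h" for t
    using in_S[of s t] that s by (intro line diff) auto
  from MVT2[OF \<open>h > 0\<close> this] obtain t where t: "0 < t" "t < h"
    "pd v f (p + s *\<^sub>R v + h *\<^sub>R w) - pd v f (p + s *\<^sub>R v)
       = h * pd w (pd v f) (p + s *\<^sub>R v + t *\<^sub>R w)" by auto
  have "\<phi> h - \<phi> 0 = h * (h * pd w (pd v f) (p + s *\<^sub>R v + t *\<^sub>R w))"
    unfolding s(3) t(3)[symmetric] by (simp add: algebra_simps)
  then show ?thesis using that[OF s(1,2) t(1,2)]
    by (simp add: \<phi>_def algebra_simps power2_eq_square)
qed

text \<open>
  Clairaut's theorem: evaluating the same second difference in two ways shows that the two mixed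
  derivatives take a common value arbitrarily close to p, and both are continuous.
\<close>
lemma pd_commute_real:
  fixes f :: "'a::real_normed_vector \<Rightarrow> real"
  assumes "smooth_on f S" "p \<in> S"
  shows "pd v (pd w f) p = pd w (pd v f) p"
proof (rule ccontr)
  assume ne: "pd v (pd w f) p \<noteq> pd w (pd v f) p"
  define e where "e = dist (pd v (pd w f) p) (pd w (pd v f) p) / 2"
  have "e > 0" using ne by (simp add: e_def)
  have cont: "isCont (pd x (pd y f)) p" for x y
    using smooth_on_continuous[of "pd x (pd y f)" S] assms smooth_on_open[OF assms(1)]
    by (auto simp: continuous_on_eq_continuous_at intro: smooth_on_pd)
  obtain d1 where d1: "d1 > 0" "\<And>q. dist q p < d1 \<Longrightarrow> dist (pd v (pd w f) q) (pd v (pd w f) p) < e"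
    using cont[of v w] \<open>e > 0\<close> unfolding continuous_at_eps_delta by (auto simp: dist_commute)
  obtain d2 where d2: "d2 > 0" "\<And>q. dist q p < d2 \<Longrightarrow> dist (pd w (pd v f) q) (pd w (pd v f) p) < e"
    using cont[of w v] \<open>e > 0\<close> unfolding continuous_at_eps_delta by (auto simp: dist_commute)
  obtain d3 where d3: "d3 > 0" "ball p d3 \<subseteq> S"
    using smooth_on_open[OF assms(1)] assms(2) open_contains_ball by blast
  define d where "d = min d1 (min d2 d3)"
  (* small enough for the whole parallelogram to lie in the ball of radius d *)
  define h where "h = d / (norm v + norm w + 1)"
  have pos: "norm v + norm w + 1 > 0" by (simp add: add_nonneg_pos)
  have "d > 0" using d1 d2 d3 by (simp add: d_def)
  with pos have "h > 0" by (simp add: h_def)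
  have near: "dist (p + s *\<^sub>R v + t *\<^sub>R w) p < d" if "0 \<le> s" "s \<le> h" "0 \<le> t" "t \<le> h" for s t
  proof -
    have "dist (p + s *\<^sub>R v + t *\<^sub>R w) p = norm (s *\<^sub>R v + t *\<^sub>R w)" by (simp add: dist_norm)
    also have "\<dots> \<le> s * norm v + t * norm w" using norm_triangle_ineq[of "s *\<^sub>R v" "t *\<^sub>R w"] that by simp
    also have "\<dots> \<le> h * norm v + h * norm w" using that by (intro add_mono mult_right_mono) auto
    also have "\<dots> < h * (norm v + norm w + 1)" using \<open>h > 0\<close> by (simp add: algebra_simps)
    also have "\<dots> = d" using pos by (simp add: h_def)
    finally show ?thesis .
  qed
  then have in_S: "p + s *\<^sub>R v + t *\<^sub>R w \<in> S" if "0 \<le> s" "s \<le> h" "0 \<le> t" "t \<le> h" for s t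
    using that d3(2) by (force simp: d_def dist_commute)
  then have in_S': "p + s *\<^sub>R w + t *\<^sub>R v \<in> S" if "0 \<le> s" "s \<le> h" "0 \<le> t" "t \<le> h" for s t
    using in_S[OF that(3,4,1,2)] by (metis add.assoc add.commute)
  have D: "q \<in> S \<Longrightarrow> f differentiable (at q)" "q \<in> S \<Longrightarrow> pd x f differentiable (at q)" for q x
    using smooth_on_differentiable assms smooth_on_pd by blast+
  obtain s t where st: "0 < s" "s < h" "0 < t" "t < h"
    "f (p + h *\<^sub>R v + h *\<^sub>R w) - f (p + h *\<^sub>R v) - f (p + h *\<^sub>R w) + f p
       = h\<^sup>2 * pd w (pd v f) (p + s *\<^sub>R v + t *\<^sub>R w)"
    using second_difference_mean_value[OF \<open>h > 0\<close> in_S D] .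
  obtain s' t' where st': "0 < s'" "s' < h" "0 < t'" "t' < h"
    "f (p + h *\<^sub>R w + h *\<^sub>R v) - f (p + h *\<^sub>R w) - f (p + h *\<^sub>R v) + f p
       = h\<^sup>2 * pd v (pd w f) (p + s' *\<^sub>R w + t' *\<^sub>R v)"
    using second_difference_mean_value[OF \<open>h > 0\<close> in_S' D] .
  have "h\<^sup>2 * pd w (pd v f) (p + s *\<^sub>R v + t *\<^sub>R w) = h\<^sup>2 * pd v (pd w f) (p + s' *\<^sub>R w + t' *\<^sub>R v)"
    unfolding st(5)[symmetric] st'(5)[symmetric] by (simp add: algebra_simps)
  then have eq: "pd w (pd v f) (p + s *\<^sub>R v + t *\<^sub>R w) = pd v (pd w f) (p + s' *\<^sub>R w + t' *\<^sub>R v)"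
    using \<open>h > 0\<close> by simp
  have "dist (pd w (pd v f) (p + s *\<^sub>R v + t *\<^sub>R w)) (pd w (pd v f) p) < e"
    using near[of s t] st by (intro d2) (auto simp: d_def)
  moreover have "dist (pd v (pd w f) (p + s' *\<^sub>R w + t' *\<^sub>R v)) (pd v (pd w f) p) < e"
    using near[of t' s'] st' by (intro d1) (auto simp: d_def algebra_simps)
  ultimately show False unfolding eq e_def by (metis dist_commute dist_triangle_half_l less_irrefl)
qed

lemma pd_commute:
  fixes f :: "'a::real_normed_vector \<Rightarrow> 'b::real_inner"
  assumes "smooth_on f S" "p \<in> S"
  shows "pd v (pd w f) p = pd w (pd v f) p"
proof (rule vector_eq_rdot[THEN iffD1], rule allI)
  fix b :: 'b
  have bl: "bounded_linear (\<lambda>z. z \<bullet> b)" by (rule bounded_linear_inner_left)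
  have *: "pd x (pd y f) p \<bullet> b = pd x (pd y (\<lambda>q. f q \<bullet> b)) p" for x y
  proof -
    have "pd x (pd y (\<lambda>q. f q \<bullet> b)) p = pd x (\<lambda>q. pd y f q \<bullet> b) p"
      using assms by (intro pd_cong_open[of S] pd_bounded_linear_comp[OF bl] smooth_on_open
          smooth_on_differentiable) auto
    also have "\<dots> = pd x (pd y f) p \<bullet> b"
      using assms by (intro pd_bounded_linear_comp[OF bl] smooth_on_differentiable smooth_on_pd)
    finally show ?thesis by simp
  qed
  show "pd v (pd w f) p \<bullet> b = pd w (pd v f) p \<bullet> b"
    unfolding * using assms(2)
    by (intro pd_commute_real[OF smooth_on_bounded_linear_comp[OF bl assms(1)]])
qed


section \<open>Separately holomorphic functions of two variables\<close>

text \<open>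
  Joint continuity is part of the notion because it makes Cauchy's integral over a circle in one
  variable depend continuously on the other variable.
\<close>
definition separately_holomorphic :: "(complex \<times> complex \<Rightarrow> complex) \<Rightarrow> (complex \<times> complex) set \<Rightarrow> bool" where
  "separately_holomorphic f S \<longleftrightarrow> open S \<and> continuous_on S f \<and>
     (\<forall>z w. (z, w) \<in> S \<longrightarrow> (\<lambda>z. f (z, w)) field_differentiable (at z) \<and>
                         (\<lambda>w. f (z, w)) field_differentiable (at w))"

definition deriv_fst :: "(complex \<times> complex \<Rightarrow> complex) \<Rightarrow> complex \<times> complex \<Rightarrow> complex" where
  "deriv_fst f = (\<lambda>(z, w). deriv (\<lambda>z. f (z, w)) z)"

definition deriv_snd :: "(complex \<times> complex \<Rightarrow> complex) \<Rightarrow> complex \<times> complex \<Rightarrow> complex" where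
  "deriv_snd f = (\<lambda>(z, w). deriv (\<lambda>w. f (z, w)) w)"

lemma open_vimage_swap: "open S \<Longrightarrow> open (prod.swap -` S)"
  for S :: "('a::topological_space \<times> 'b::topological_space) set"
  by (rule open_vimage) (auto simp: prod.swap_def intro!: continuous_intros)

lemma separately_holomorphic_swap: "separately_holomorphic f S \<Longrightarrow> separately_holomorphic (f \<circ> prod.swap) (prod.swap -` S)"
  unfolding separately_holomorphic_def
  by (auto simp: open_vimage_swap prod.swap_def intro!: continuous_on_Pair continuous_on_snd continuous_on_fst continuous_on_id
      continuous_on_compose2[of S f "prod.swap -` S" "\<lambda>p. (snd p, fst p)"])

lemma deriv_snd_eq_swap: "deriv_snd f = deriv_fst (f \<circ> prod.swap) \<circ> prod.swap"
  by (auto simp: deriv_snd_def deriv_fst_def)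

lemma open_product_cball:
  fixes S :: "('a::metric_space \<times> 'b::metric_space) set"
  assumes "open S" "(a, b) \<in> S"
  obtains r where "r > 0" "cball a r \<times> cball b r \<subseteq> S"
proof -
  from assms obtain A B where AB: "open A" "open B" "a \<in> A" "b \<in> B" "A \<times> B \<subseteq> S"
    by (rule open_prod_elim[of S "(a, b)"]) auto
  obtain r1 r2 where "r1 > 0" "cball a r1 \<subseteq> A" "r2 > 0" "cball b r2 \<subseteq> B"
    using AB open_contains_cball by metis
  then have "cball a (min r1 r2) \<times> cball b (min r1 r2) \<subseteq> S" "min r1 r2 > 0"
    using AB(5) by (auto simp: subset_iff)
  then show ?thesis using that by blast
qed

text \<open>
  Inside a product of discs, Cauchy's formula represents the first partial derivative as an integral
  over a circle, and regularity in the second variable passes through the integral.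
\<close>
context
  fixes f S a b and r :: real
  assumes hol: "separately_holomorphic f S" and r: "r > 0" "cball a r \<times> cball b r \<subseteq> S"
begin

text \<open>
  The integrand of Cauchy's formula for the first derivative, pulled back to the unit interval by
  the standard parametrization of the circle.
\<close>
private definition kernel where
  "kernel z w t = f (circlepath a r t, w) / (circlepath a r t - z)\<^sup>2 *
     (2 * pi * \<i> * r * exp (2 * of_real pi * \<i> * of_real t))"

private lemma circle_in: "circlepath a r t \<in> cball a r" "dist a (circlepath a r t) = r"
  using r(1) by (simp_all add: circlepath dist_norm norm_mult)

private lemma circle_ne: "z \<in> ball a r \<Longrightarrow> circlepath a r t - z \<noteq> 0"
  using circle_in(2)[of t] by auto

private lemma deriv_fst_integral:
  assumes "z \<in> ball a r" "w \<in> cball b r"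
  shows "deriv_fst f (z, w) = 1 / (2 * of_real pi * \<i>) * integral {0..1} (kernel z w)"
proof -
  have fd: "(\<lambda>z. f (z, w)) field_differentiable (at z)" if "z \<in> cball a r" for z
    using hol subsetD[OF r(2), of "(z, w)"] that assms(2) by (simp add: separately_holomorphic_def)
  have "((\<lambda>z. f (z, w)) has_field_derivative 1 / (2 * of_real pi * \<i>) *
      contour_integral (circlepath a r) (\<lambda>u. f (u, w) / (u - z)\<^sup>2)) (at z)"
  proof (rule Cauchy_derivative_integral_circlepath(2))
    show "continuous_on (cball a r) (\<lambda>z. f (z, w))"
      by (intro continuous_at_imp_continuous_on ballI field_differentiable_imp_continuous_at fd)
    show "(\<lambda>z. f (z, w)) holomorphic_on ball a r"
      using fd by (auto simp: holomorphic_on_def intro: field_differentiable_at_within)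
  qed (use assms in auto)
  then have "deriv_fst f (z, w) = 1 / (2 * of_real pi * \<i>) *
      contour_integral (circlepath a r) (\<lambda>u. f (u, w) / (u - z)\<^sup>2)"
    by (simp add: deriv_fst_def DERIV_imp_deriv)
  also have "contour_integral (circlepath a r) (\<lambda>u. f (u, w) / (u - z)\<^sup>2) = integral {0..1} (kernel z w)"
    unfolding contour_integral_integral
    by (simp add: kernel_def[abs_def] vector_derivative_circlepath)
  finally show ?thesis .
qed

private lemma continuous_circlepath:
  "continuous_on T g \<Longrightarrow> continuous_on T (\<lambda>x. circlepath a r (g x))"
  unfolding circlepath by (intro continuous_intros)

private lemma continuous_f: "continuous_on S f"
  using hol by (simp add: separately_holomorphic_def)

private lemma continuous_kernel:
  "continuous_on ((ball a r \<times> ball b r) \<times> cbox 0 1) (\<lambda>(p, t). kernel (fst p) (snd p) t)"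
  unfolding kernel_def split_beta
proof (intro continuous_intros continuous_circlepath continuous_on_compose2[OF continuous_f])
  show "(\<lambda>x. (circlepath a r (snd x), snd (fst x))) ` ((ball a r \<times> ball b r) \<times> cbox 0 1) \<subseteq> S"
    using r(2) circle_in(1) by (auto intro!: subsetD[OF r(2)])
  show "\<forall>x\<in>(ball a r \<times> ball b r) \<times> cbox 0 1. (circlepath a r (snd x) - fst (fst x))\<^sup>2 \<noteq> 0"
    using circle_ne by (auto simp del: right_minus_eq)
qed

lemma continuous_deriv_fst_local: "continuous_on (ball a r \<times> ball b r) (deriv_fst f)"
proof -
  have "continuous_on (ball a r \<times> ball b r)
      (\<lambda>p. 1 / (2 * of_real pi * \<i>) * integral (cbox 0 1) (kernel (fst p) (snd p)))"
    using continuous_kernel by (intro continuous_intros integral_continuous_on_param)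
  then show ?thesis
    by (rule continuous_on_eq) (auto simp: deriv_fst_integral)
qed

text \<open>
  Differentiation under the integral sign needs a continuous w-derivative of the integrand, which is
  provided by the continuity of the other partial derivative of f.
\<close>
lemma holomorphic_deriv_fst_local:
  assumes cont: "continuous_on S (deriv_snd f)" and z: "z \<in> ball a r"
  shows "(\<lambda>w. deriv_fst f (z, w)) holomorphic_on ball b r"
proof -
  have "(\<lambda>w. integral (cbox 0 1) (kernel z w)) holomorphic_on ball b r"
  proof (rule leibniz_rule_holomorphic)
    fix w and t :: real
    assume w: "w \<in> ball b r" and t: "t \<in> cbox 0 1"
    have "(circlepath a r t, w) \<in> S" using r(2) circle_in(1) w by auto
    then have "(\<lambda>w. f (circlepath a r t, w)) field_differentiable (at w)"
      using hol by (simp add: separately_holomorphic_def)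
    then have "((\<lambda>w. f (circlepath a r t, w)) has_field_derivative
        deriv_snd f (circlepath a r t, w)) (at w within ball b r)"
      by (simp add: deriv_snd_def DERIV_deriv_iff_field_differentiable has_field_derivative_at_within)
    then show "((\<lambda>w. kernel z w t) has_field_derivative
        deriv_snd f (circlepath a r t, w) / (circlepath a r t - z)\<^sup>2 *
        (2 * pi * \<i> * r * exp (2 * of_real pi * \<i> * of_real t))) (at w within ball b r)"
      unfolding kernel_def by (intro DERIV_cmult_right DERIV_cdivide)
  next
    fix w assume w: "w \<in> ball b r"
    have "continuous_on (cbox 0 1) (\<lambda>t. case ((z, w), t) of (p, t) \<Rightarrow> kernel (fst p) (snd p) t)"
      by (rule continuous_on_compose2[OF continuous_kernel])
        (use z w in \<open>auto intro!: continuous_on_Pair continuous_on_const continuous_on_id\<close>)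
    then show "kernel z w integrable_on cbox 0 1" by (intro integrable_continuous) simp
  next
    show "continuous_on (ball b r \<times> cbox 0 1) (\<lambda>(w, t). deriv_snd f (circlepath a r t, w) /
        (circlepath a r t - z)\<^sup>2 * (2 * pi * \<i> * r * exp (2 * of_real pi * \<i> * of_real t)))"
      unfolding split_beta
    proof (intro continuous_intros continuous_circlepath continuous_on_compose2[OF cont])
      show "(\<lambda>x. (circlepath a r (snd x), fst x)) ` (ball b r \<times> cbox 0 1) \<subseteq> S"
        using circle_in(1) by (auto intro!: subsetD[OF r(2)])
      show "\<forall>x\<in>ball b r \<times> cbox 0 1. (circlepath a r (snd x) - z)\<^sup>2 \<noteq> 0"
        using circle_ne[OF z] by simp
    qed
  qed simp_all
  then have "(\<lambda>w. 1 / (2 * of_real pi * \<i>) * integral (cbox 0 1) (kernel z w)) holomorphic_on ball b r"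
    by (intro holomorphic_intros)
  then show ?thesis
    by (rule holomorphic_transform) (use z in \<open>auto simp: deriv_fst_integral\<close>)
qed

end

lemma continuous_deriv_fst:
  assumes "separately_holomorphic f S"
  shows "continuous_on S (deriv_fst f)"
proof (rule continuous_at_imp_continuous_on, rule ballI)
  fix p assume "p \<in> S"
  obtain a b where p: "p = (a, b)" by (cases p)
  obtain r where r: "r > 0" "cball a r \<times> cball b r \<subseteq> S"
    using open_product_cball[of S a b] assms \<open>p \<in> S\<close> unfolding separately_holomorphic_def p by blast
  have "continuous_on (ball a r \<times> ball b r) (deriv_fst f)"
    by (rule continuous_deriv_fst_local[OF assms r])
  then show "isCont (deriv_fst f) p"
    using r(1) by (auto simp: p continuous_on_eq_continuous_at open_Times)
qed

lemma continuous_deriv_snd: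
  assumes "separately_holomorphic f S"
  shows "continuous_on S (deriv_snd f)"
  unfolding deriv_snd_eq_swap
  by (rule continuous_on_compose[OF _ continuous_on_subset[OF
        continuous_deriv_fst[OF separately_holomorphic_swap[OF assms]]]])
    (auto simp: prod.swap_def intro!: continuous_intros)

lemma separately_holomorphic_deriv_fst:
  assumes "separately_holomorphic f S"
  shows "separately_holomorphic (deriv_fst f) S"
  unfolding separately_holomorphic_def
proof (intro conjI allI impI)
  show op: "open S" using assms by (simp add: separately_holomorphic_def)
  show "continuous_on S (deriv_fst f)" by (rule continuous_deriv_fst[OF assms])
  fix z w assume zw: "(z, w) \<in> S"
  obtain r where r: "r > 0" "cball z r \<times> cball w r \<subseteq> S"
    using open_product_cball[OF op zw] .
  have "(\<lambda>z. f (z, w)) holomorphic_on ball z r"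
    unfolding holomorphic_on_def
  proof
    fix x assume "x \<in> ball z r"
    then have "(x, w) \<in> S" using r by auto
    then show "(\<lambda>z. f (z, w)) field_differentiable at x within ball z r"
      using assms by (auto simp: separately_holomorphic_def intro: field_differentiable_at_within)
  qed
  from holomorphic_deriv[OF this open_ball]
  have "(\<lambda>z. deriv_fst f (z, w)) holomorphic_on ball z r" by (simp add: deriv_fst_def)
  then show "(\<lambda>z. deriv_fst f (z, w)) field_differentiable at z"
    using r(1) holomorphic_on_imp_differentiable_at[OF _ open_ball, of _ z r z] by simp
  have "(\<lambda>w. deriv_fst f (z, w)) holomorphic_on ball w r"
    using holomorphic_deriv_fst_local[OF assms r continuous_deriv_snd[OF assms], of z] r(1) by simp
  then show "(\<lambda>w. deriv_fst f (z, w)) field_differentiable at w"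
    using r(1) holomorphic_on_imp_differentiable_at[OF _ open_ball, of _ w r w] by simp
qed

lemma separately_holomorphic_deriv_snd:
  assumes "separately_holomorphic f S"
  shows "separately_holomorphic (deriv_snd f) S"
proof -
  have "prod.swap -` (prod.swap -` S) = S" by auto
  with separately_holomorphic_swap[OF separately_holomorphic_deriv_fst[OF separately_holomorphic_swap[OF assms]]]
  show ?thesis by (simp add: deriv_snd_eq_swap)
qed

text \<open>
  Continuity of one partial derivative turns the two partial derivatives into a total one; the
  derivative in any real direction is then a combination of the complex partial derivatives.
\<close>
lemma separately_holomorphic_has_derivative:
  assumes "separately_holomorphic f S" "p \<in> S"
  shows "(f has_derivative (\<lambda>v. deriv_fst f p * fst v + deriv_snd f p * snd v)) (at p)"
proof -
  obtain a b where p: "p = (a, b)" by (cases p)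
  have op: "open S" using assms(1) by (simp add: separately_holomorphic_def)
  obtain r where r: "r > 0" "cball a r \<times> cball b r \<subseteq> S"
    using open_product_cball[OF op] assms(2) unfolding p by blast
  have inS: "(z, w) \<in> S" if "z \<in> ball a r" "w \<in> ball b r" for z w
    using r(2) that by auto
  have "((\<lambda>(z, w). f (z, w)) has_derivative
      (\<lambda>(h, k). deriv_fst f (a, b) * h + blinfun_apply (blinfun_mult_right (deriv_snd f (a, b))) k))
      (at (a, b) within ball a r \<times> ball b r)"
  proof (rule has_derivative_partialsI)
    show "((\<lambda>z. f (z, b)) has_derivative (*) (deriv_fst f (a, b))) (at a within ball a r)"
      using assms(1) inS[of a b] r(1)
      by (auto simp: separately_holomorphic_def deriv_fst_def DERIV_deriv_iff_field_differentiable[symmetric]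
          has_field_derivative_def intro: has_derivative_at_withinI)
    fix z w assume zw: "z \<in> ball a r" "w \<in> ball b r"
    show "((\<lambda>w. f (z, w)) has_derivative blinfun_apply (blinfun_mult_right (deriv_snd f (z, w))))
        (at w within ball b r)"
      using assms(1) inS[OF zw]
      by (auto simp: separately_holomorphic_def deriv_snd_def DERIV_deriv_iff_field_differentiable[symmetric]
          has_field_derivative_def intro: has_derivative_at_withinI)
  next
    have "continuous_on (ball a r \<times> ball b r) (\<lambda>p. blinfun_mult_right (deriv_snd f p))"
      using r(2) by (intro bounded_linear.continuous_on[OF bounded_linear_blinfun_mult_right]
          continuous_on_subset[OF continuous_deriv_snd[OF assms(1)]]) auto
    then show "continuous (at (a, b) within ball a r \<times> ball b r)
        (\<lambda>(z, w). blinfun_mult_right (deriv_snd f (z, w)))"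
      using r(1) by (simp add: continuous_on_eq_continuous_within case_prod_unfold)
  qed (use r(1) in auto)
  then show ?thesis
    using r(1) by (simp add: p at_within_open[of _ "ball a r \<times> ball b r"] open_Times case_prod_unfold)
qed

text \<open>
  By the preceding formula a directional derivative is a combination of functions of the same class,
  so that induction on the order applies.
\<close>
lemma separately_holomorphic_smooth_on:
  assumes "separately_holomorphic f S"
  shows "smooth_on f S"
proof -
  have op: "open S" using assms by (simp add: separately_holomorphic_def)
  have "Ck_on n f S" for n
    using assms
  proof (induction n arbitrary: f)
    case 0
    then show ?case by (simp add: separately_holomorphic_def)
  next
    case (Suc n)
    note D = separately_holomorphic_has_derivative[OF Suc.prems]
    have "Ck_on n (pd v f) S" for v
    proof (rule Ck_on_cong[OF op])
      show "Ck_on n (\<lambda>p. deriv_fst f p * fst v + deriv_snd f p * snd v) S"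
        by (intro Ck_on_add[OF op] Ck_on_bilinear[OF op bounded_bilinear_mult] Ck_on_const
            Suc.IH separately_holomorphic_deriv_fst separately_holomorphic_deriv_snd Suc.prems)
    qed (simp add: has_derivative_imp_pd[OF D])
    moreover have "f differentiable (at p)" if "p \<in> S" for p
      using D[OF that] by (rule differentiableI)
    ultimately show ?case by simp
  qed
  then show ?thesis by (simp add: smooth_on_def op)
qed

lemma Cauchy_Riemann_field_differentiable:
  fixes a b :: "'a::real_normed_vector \<Rightarrow> real" and \<phi> :: "complex \<Rightarrow> 'a"
  assumes \<phi>: "(\<phi> has_derivative (\<lambda>h. Re h *\<^sub>R x + Im h *\<^sub>R y)) (at z)"
    and diff: "a differentiable (at (\<phi> z))" "b differentiable (at (\<phi> z))"
    and CR: "pd x a (\<phi> z) = pd y b (\<phi> z)" "pd y a (\<phi> z) = - pd x b (\<phi> z)"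
  shows "(\<lambda>z. Complex (a (\<phi> z)) (b (\<phi> z))) field_differentiable (at z)"
proof -
  note lin = linear_pd[OF diff(1)] linear_pd[OF diff(2)]
  have chain: "((\<lambda>z. g (\<phi> z)) has_derivative (\<lambda>h. Re h * pd x g (\<phi> z) + Im h * pd y g (\<phi> z))) (at z)"
    if "g differentiable (at (\<phi> z))" for g :: "'a \<Rightarrow> real"
    using diff_chain_at[OF \<phi> has_derivative_pd[OF that]]
    by (simp add: o_def linear_add[OF linear_pd[OF that]] linear_cmul[OF linear_pd[OF that]])
  have "((\<lambda>z. complex_of_real (a (\<phi> z)) + \<i> * complex_of_real (b (\<phi> z))) has_derivative
      (\<lambda>h. complex_of_real (Re h * pd x a (\<phi> z) + Im h * pd y a (\<phi> z)) +
        \<i> * complex_of_real (Re h * pd x b (\<phi> z) + Im h * pd y b (\<phi> z)))) (at z)"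
    by (intro has_derivative_add has_derivative_mult_right
        bounded_linear.has_derivative[OF bounded_linear_of_real] chain diff)
  then have "((\<lambda>z. Complex (a (\<phi> z)) (b (\<phi> z))) has_derivative
      (\<lambda>h. Complex (pd x a (\<phi> z)) (pd x b (\<phi> z)) * h)) (at z)"
    unfolding Complex_eq using CR
    by (elim has_derivative_eq_rhs) (auto simp: fun_eq_iff complex_eq_iff algebra_simps)
  then show ?thesis
    using field_differentiable_def has_field_derivative_def by blast
qed

lemma C1_on_differentiable: "C1_on f S \<Longrightarrow> p \<in> S \<Longrightarrow> f differentiable (at p)"
  unfolding C1_on_def differentiable_def by blast

text \<open>
  The sign \<sigma> says whether a + i b is holomorphic or antiholomorphic in the second complex variable;
  the latter case is reduced to the former by a reflection of the last coordinate.
\<close>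
lemma smooth_on_of_double_Cauchy_Riemann:
  fixes a b :: "plane2 \<Rightarrow> real" and \<sigma> :: real
  assumes "open \<Xi>" "\<sigma> * \<sigma> = 1"
    and diff: "\<And>p. p \<in> \<Xi> \<Longrightarrow> a differentiable (at p)" "\<And>p. p \<in> \<Xi> \<Longrightarrow> b differentiable (at p)"
    and CR1: "\<And>p. p \<in> \<Xi> \<Longrightarrow> pd ((1, 0), (0, 0)) a p = pd ((0, 1), (0, 0)) b p"
      "\<And>p. p \<in> \<Xi> \<Longrightarrow> pd ((0, 1), (0, 0)) a p = - pd ((1, 0), (0, 0)) b p"
    and CR2: "\<And>p. p \<in> \<Xi> \<Longrightarrow> pd ((0, 0), (1, 0)) a p = \<sigma> * pd ((0, 0), (0, 1)) b p"
      "\<And>p. p \<in> \<Xi> \<Longrightarrow> pd ((0, 0), (0, 1)) a p = - \<sigma> * pd ((0, 0), (1, 0)) b p"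
  shows "smooth_on a \<Xi>" "smooth_on b \<Xi>"
proof -
  (* \<phi> passes from complex to real coordinates, and \<psi> is its inverse *)
  define \<phi> where "\<phi> p = ((Re (fst p), Im (fst p)), (Re (snd p), \<sigma> * Im (snd p)))" for p
  define \<psi> where "\<psi> q = (Complex (fst (fst q)) (snd (fst q)), Complex (fst (snd q)) (\<sigma> * snd (snd q)))"
    for q :: plane2
  have \<phi>\<psi>: "\<phi> (\<psi> q) = q" for q
    using assms(2) by (simp add: \<phi>_def \<psi>_def mult.assoc[symmetric])
  define S where "S = \<phi> -` \<Xi>"
  define f where "f p = Complex (a (\<phi> p)) (b (\<phi> p))" for p
  have cont\<phi>: "continuous_on T \<phi>" for T unfolding \<phi>_def by (intro continuous_intros)
  have "separately_holomorphic f S"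
    unfolding separately_holomorphic_def
  proof (intro conjI allI impI)
    show "open S" unfolding S_def using assms(1) cont\<phi> by (rule open_vimage)
    have ab: "continuous_on \<Xi> a" "continuous_on \<Xi> b"
      using diff by (auto intro!: continuous_at_imp_continuous_on differentiable_imp_continuous_within)
    show "continuous_on S f"
      unfolding f_def Complex_eq
      by (intro continuous_intros continuous_on_compose2[OF ab(1) cont\<phi>]
          continuous_on_compose2[OF ab(2) cont\<phi>]) (auto simp: S_def)
    fix z w assume "(z, w) \<in> S"
    then have p: "\<phi> (z, w) \<in> \<Xi>" by (simp add: S_def)
    have "((\<lambda>z. \<phi> (z, w)) has_derivative (\<lambda>h. Re h *\<^sub>R ((1, 0), (0, 0)) + Im h *\<^sub>R ((0, 1), (0, 0)))) (at z)"
      unfolding \<phi>_def by (auto intro!: derivative_eq_intros simp: zero_prod_def)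
    from Cauchy_Riemann_field_differentiable[OF this diff[OF p] CR1[OF p]]
    show "(\<lambda>z. f (z, w)) field_differentiable (at z)" by (simp add: f_def)
    have "((\<lambda>w. \<phi> (z, w)) has_derivative (\<lambda>h. Re h *\<^sub>R ((0, 0), (1, 0)) + Im h *\<^sub>R (\<sigma> *\<^sub>R ((0, 0), (0, 1))))) (at w)"
      unfolding \<phi>_def by (auto intro!: derivative_eq_intros simp: zero_prod_def)
    from Cauchy_Riemann_field_differentiable[OF this diff[OF p]]
    show "(\<lambda>w. f (z, w)) field_differentiable (at w)"
      using CR2[OF p] assms(2)
      by (simp add: f_def linear_cmul[OF linear_pd[OF diff(1)[OF p]]]
          linear_cmul[OF linear_pd[OF diff(2)[OF p]]] mult.assoc[symmetric] del: scaleR_Pair)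
  qed
  then have f: "smooth_on f S" by (rule separately_holomorphic_smooth_on)
  have "bounded_linear \<psi>"
    unfolding \<psi>_def Complex_eq by (intro linear_conv_bounded_linear[THEN iffD1] linearI)
      (auto simp: algebra_simps scaleR_conv_of_real)
  then have \<psi>: "smooth_on \<psi> \<Xi>" using assms(1) by (rule smooth_on_bounded_linear)
  have "smooth_on (\<lambda>q. f (\<psi> q)) \<Xi>"
    using \<phi>\<psi> by (intro smooth_on_compose[OF f \<psi>]) (auto simp: S_def)
  then have "smooth_on (\<lambda>q. Re (f (\<psi> q))) \<Xi>" "smooth_on (\<lambda>q. Im (f (\<psi> q))) \<Xi>"
    by (auto intro: smooth_on_bounded_linear_comp[OF bounded_linear_Re]
        smooth_on_bounded_linear_comp[OF bounded_linear_Im])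
  then show "smooth_on a \<Xi>" "smooth_on b \<Xi>" by (simp_all add: f_def \<phi>\<psi>)
qed

text \<open>
  With commuting square roots i and j of -1, the four systems say that u1 + i v1 + j u2 + i j v2 is
  holomorphic in x1 + i y1 and x2 + j y2 over the bicomplex numbers. This algebra is a product of
  two copies of the complex numbers, with projections j = i and j = -i; the images under them are
  the two combinations treated in the proof, and they determine the four functions.
\<close>
lemma bicomplex_Cauchy_Riemann_smooth:
  fixes u1 v1 u2 v2 :: "plane2 \<Rightarrow> real"
  assumes "open \<Xi>" "C1_on u1 \<Xi>" "C1_on v1 \<Xi>" "C1_on u2 \<Xi>" "C1_on v2 \<Xi>"
    and "cauchy_riemann_1 u1 v1 \<Xi>" "cauchy_riemann_1 u2 v2 \<Xi>"
    and "cauchy_riemann_2 u1 u2 \<Xi>" "cauchy_riemann_2 v1 v2 \<Xi>"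
  shows "smooth_on u1 \<Xi>" "smooth_on v1 \<Xi>" "smooth_on u2 \<Xi>" "smooth_on v2 \<Xi>"
proof -
  note D = assms(2-5)[THEN C1_on_differentiable]
  note CR = assms(6-9)[unfolded cauchy_riemann_1_def cauchy_riemann_2_def, rule_format]
  have A: "smooth_on (\<lambda>p. u1 p - v2 p) \<Xi>" "smooth_on (\<lambda>p. v1 p + u2 p) \<Xi>"
    using smooth_on_of_double_Cauchy_Riemann[OF assms(1), of 1 "\<lambda>p. u1 p - v2 p" "\<lambda>p. v1 p + u2 p"] D CR
    by (auto simp: pd_add pd_diff)
  have B: "smooth_on (\<lambda>p. u1 p + v2 p) \<Xi>" "smooth_on (\<lambda>p. v1 p - u2 p) \<Xi>"
    using smooth_on_of_double_Cauchy_Riemann[OF assms(1), of "-1" "\<lambda>p. u1 p + v2 p" "\<lambda>p. v1 p - u2 p"] D CR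
    by (auto simp: pd_add pd_diff)
  have half: "smooth_on (\<lambda>p. (f p + g p) * (1/2)) \<Xi>" if "smooth_on f \<Xi>" "smooth_on g \<Xi>" for f g :: "plane2 \<Rightarrow> real"
    using that assms(1) by (intro smooth_on_mult smooth_on_add smooth_on_const)
  show "smooth_on u1 \<Xi>" by (rule smooth_on_cong[OF half[OF A(1) B(1)]]) simp
  show "smooth_on v1 \<Xi>" by (rule smooth_on_cong[OF half[OF A(2) B(2)]]) simp
  show "smooth_on u2 \<Xi>" by (rule smooth_on_cong[OF half[OF A(2) smooth_on_uminus[OF B(2)]]]) simp
  show "smooth_on v2 \<Xi>" by (rule smooth_on_cong[OF half[OF B(1) smooth_on_uminus[OF A(1)]]]) simp
qed


section \<open>Laplace and Dirac operators with constant coefficients\<close>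

definition laplacian :: "('i::finite \<Rightarrow> 'a::real_normed_vector) \<Rightarrow> ('a \<Rightarrow> 'b::real_normed_vector) \<Rightarrow> 'a \<Rightarrow> 'b" where
  "laplacian w f p = (\<Sum>i\<in>UNIV. pd (w i) (pd (w i) f) p)"

text \<open>
  The coefficients act on values by arbitrary maps, so that multiplication from the left and from
  the right are both covered.
\<close>
definition dirac ::
  "('i::finite \<Rightarrow> 'a::real_normed_vector) \<Rightarrow> ('i \<Rightarrow> 'b \<Rightarrow> 'b) \<Rightarrow> ('a \<Rightarrow> 'b::real_normed_vector) \<Rightarrow> 'a \<Rightarrow> 'b" where
  "dirac w A f p = (\<Sum>i\<in>UNIV. A i (pd (w i) f p))"

lemma smooth_on_laplacian: "smooth_on f S \<Longrightarrow> smooth_on (laplacian w f) S"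
  unfolding laplacian_def[abs_def]
  by (intro smooth_on_sum smooth_on_pd) (auto simp: smooth_on_open)

lemma smooth_on_laplacian_funpow: "smooth_on f S \<Longrightarrow> smooth_on ((laplacian w ^^ n) f) S"
  by (induction n) (auto simp: smooth_on_laplacian)

lemma smooth_on_dirac:
  assumes "\<And>i. bounded_linear (A i)" "smooth_on f S"
  shows "smooth_on (dirac w A f) S"
  unfolding dirac_def[abs_def]
  by (intro smooth_on_sum smooth_on_bounded_linear_comp[OF assms(1)] smooth_on_pd assms(2)
      smooth_on_open[OF assms(2)])

lemma laplacian_cong_open:
  assumes "open S" "p \<in> S" "\<And>q. q \<in> S \<Longrightarrow> f q = g q"
  shows "laplacian w f p = laplacian w g p"
  unfolding laplacian_def by (intro sum.cong refl pd_cong_open[OF assms(1)] assms(2,3))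

lemma laplacian_funpow_cong_open:
  assumes "open S" "p \<in> S" "\<And>q. q \<in> S \<Longrightarrow> f q = g q"
  shows "(laplacian w ^^ n) f p = (laplacian w ^^ n) g p"
  using assms(2)
proof (induction n arbitrary: p)
  case (Suc n)
  then show ?case using laplacian_cong_open[OF assms(1) Suc.prems Suc.IH] by simp
qed (simp add: assms(3))

lemma laplacian_zero [simp]: "laplacian w (\<lambda>x. 0) = (\<lambda>x. 0)"
proof -
  have "pd v (\<lambda>x::'a. 0 :: 'b) = (\<lambda>x. 0)" for v by auto
  then show ?thesis by (auto simp: laplacian_def)
qed

lemma laplacian_funpow_zero [simp]: "(laplacian w ^^ n) (\<lambda>x. 0) = (\<lambda>x. 0)"
  by (induction n) auto

lemma laplacian_bounded_linear_comp:
  assumes "bounded_linear A" "smooth_on f S" "p \<in> S"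
  shows "laplacian w (\<lambda>q. A (f q)) p = A (laplacian w f p)"
proof -
  have "pd v (pd v (\<lambda>q. A (f q))) p = A (pd v (pd v f) p)" for v
  proof -
    have "pd v (pd v (\<lambda>q. A (f q))) p = pd v (\<lambda>q. A (pd v f q)) p"
      by (rule pd_cong_open[OF smooth_on_open[OF assms(2)] assms(3)])
        (rule pd_bounded_linear_comp[OF assms(1) smooth_on_differentiable[OF assms(2)]])
    also have "\<dots> = A (pd v (pd v f) p)"
      by (rule pd_bounded_linear_comp[OF assms(1) smooth_on_differentiable[OF smooth_on_pd[OF assms(2)] assms(3)]])
    finally show ?thesis .
  qed
  then show ?thesis
    using assms(1) by (simp add: laplacian_def linear_sum bounded_linear.linear)
qed

lemma pd_sum_smooth:
  assumes "\<And>i. i \<in> I \<Longrightarrow> smooth_on (f i) S" "p \<in> S"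
  shows "pd v (\<lambda>q. \<Sum>i\<in>I. f i q) p = (\<Sum>i\<in>I. pd v (f i) p)"
  by (rule pd_sum[OF smooth_on_differentiable[OF assms(1) assms(2)]])

lemma laplacian_sum:
  assumes "open S" "\<And>i. i \<in> I \<Longrightarrow> smooth_on (f i) S" "p \<in> S"
  shows "laplacian w (\<lambda>q. \<Sum>i\<in>I. f i q) p = (\<Sum>i\<in>I. laplacian w (f i) p)"
proof -
  have "pd v (pd v (\<lambda>q. \<Sum>i\<in>I. f i q)) p = (\<Sum>i\<in>I. pd v (pd v (f i)) p)" for v
  proof -
    have "pd v (pd v (\<lambda>q. \<Sum>i\<in>I. f i q)) p = pd v (\<lambda>q. \<Sum>i\<in>I. pd v (f i) q) p"
      by (rule pd_cong_open[OF assms(1,3)]) (rule pd_sum_smooth[OF assms(2)])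
    also have "\<dots> = (\<Sum>i\<in>I. pd v (pd v (f i)) p)"
      by (rule pd_sum_smooth[OF smooth_on_pd[OF assms(2)] assms(3)])
    finally show ?thesis .
  qed
  then show ?thesis by (simp add: laplacian_def sum.swap[of _ UNIV I])
qed

lemma laplacian_add:
  assumes "smooth_on f S" "smooth_on g S" "p \<in> S"
  shows "laplacian w (\<lambda>q. f q + g q) p = laplacian w f p + laplacian w g p"
  using laplacian_sum[of S "UNIV :: bool set" "\<lambda>b. if b then f else g" p w] assms
  by (simp add: UNIV_bool smooth_on_open add.commute)

lemma laplacian_funpow_add:
  assumes "smooth_on f S" "smooth_on g S" "p \<in> S"
  shows "(laplacian w ^^ n) (\<lambda>q. f q + g q) p = (laplacian w ^^ n) f p + (laplacian w ^^ n) g p"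
  using assms(3)
proof (induction n arbitrary: p)
  case (Suc n)
  have "(laplacian w ^^ Suc n) (\<lambda>q. f q + g q) p = laplacian w (\<lambda>q. (laplacian w ^^ n) f q + (laplacian w ^^ n) g q) p"
    using laplacian_cong_open[OF smooth_on_open[OF assms(1)] Suc.prems Suc.IH] by simp
  also have "\<dots> = (laplacian w ^^ Suc n) f p + (laplacian w ^^ Suc n) g p"
    using laplacian_add[OF smooth_on_laplacian_funpow[OF assms(1)] smooth_on_laplacian_funpow[OF assms(2)] Suc.prems] by simp
  finally show ?case .
qed simp

lemma laplacian_pd_commute:
  fixes f :: "'a::real_normed_vector \<Rightarrow> 'b::real_inner"
  assumes "smooth_on f S" "p \<in> S"
  shows "laplacian w (pd v f) p = pd v (laplacian w f) p"
proof -
  have op: "open S" by (rule smooth_on_open[OF assms(1)])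
  have "pd x (pd x (pd v f)) p = pd v (pd x (pd x f)) p" for x
  proof -
    have "pd x (pd x (pd v f)) p = pd x (pd v (pd x f)) p"
      by (rule pd_cong_open[OF op assms(2)]) (rule pd_commute[OF assms(1)])
    also have "\<dots> = pd v (pd x (pd x f)) p"
      by (rule pd_commute[OF smooth_on_pd[OF assms(1)] assms(2)])
    finally show ?thesis .
  qed
  then have "laplacian w (pd v f) p = (\<Sum>i\<in>UNIV. pd v (pd (w i) (pd (w i) f)) p)"
    by (simp add: laplacian_def)
  also have "\<dots> = pd v (laplacian w f) p"
    unfolding laplacian_def[abs_def] by (rule pd_sum_smooth[symmetric, OF _ assms(2)])
      (intro smooth_on_pd assms(1))
  finally show ?thesis .
qed

lemma laplacian_dirac_commute:
  fixes f :: "'a::real_normed_vector \<Rightarrow> 'b::real_inner"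
  assumes "\<And>i. bounded_linear (A i)" "smooth_on f S" "p \<in> S"
  shows "dirac w A (laplacian w' f) p = laplacian w' (dirac w A f) p"
proof -
  have "laplacian w' (dirac w A f) p = (\<Sum>i\<in>UNIV. laplacian w' (\<lambda>q. A i (pd (w i) f q)) p)"
    unfolding dirac_def[abs_def]
    by (rule laplacian_sum[OF smooth_on_open[OF assms(2)] _ assms(3)])
      (rule smooth_on_bounded_linear_comp[OF assms(1) smooth_on_pd[OF assms(2)]])
  also have "\<dots> = (\<Sum>i\<in>UNIV. A i (laplacian w' (pd (w i) f) p))"
    by (intro sum.cong refl laplacian_bounded_linear_comp[OF assms(1) smooth_on_pd[OF assms(2)] assms(3)])
  finally show ?thesis by (simp add: dirac_def laplacian_pd_commute[OF assms(2,3)])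
qed

lemma dirac_laplacian_funpow_commute:
  fixes f :: "'a::real_normed_vector \<Rightarrow> 'b::real_inner"
  assumes "\<And>i. bounded_linear (A i)" "smooth_on f S" "p \<in> S"
  shows "dirac w A ((laplacian w' ^^ n) f) p = (laplacian w' ^^ n) (dirac w A f) p"
  using assms(3)
proof (induction n arbitrary: p)
  case (Suc n)
  have "dirac w A ((laplacian w' ^^ Suc n) f) p = laplacian w' (dirac w A ((laplacian w' ^^ n) f)) p"
    using laplacian_dirac_commute[OF assms(1) smooth_on_laplacian_funpow[OF assms(2)] Suc.prems] by simp
  also have "\<dots> = (laplacian w' ^^ Suc n) (dirac w A f) p"
    using laplacian_cong_open[OF smooth_on_open[OF assms(2)] Suc.prems Suc.IH] by simp
  finally show ?case .
qed simp

lemma laplacian_commute: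
  fixes f :: "'a::real_normed_vector \<Rightarrow> 'b::real_inner"
  assumes "smooth_on f S" "p \<in> S"
  shows "laplacian w (laplacian w' f) p = laplacian w' (laplacian w f) p"
proof -
  have op: "open S" by (rule smooth_on_open[OF assms(1)])
  have "pd v (pd v (laplacian w' f)) p = laplacian w' (pd v (pd v f)) p" for v
  proof -
    have "pd v (pd v (laplacian w' f)) p = pd v (laplacian w' (pd v f)) p"
      by (rule pd_cong_open[OF op assms(2)]) (rule laplacian_pd_commute[OF assms(1), symmetric])
    also have "\<dots> = laplacian w' (pd v (pd v f)) p"
      by (rule laplacian_pd_commute[OF smooth_on_pd[OF assms(1)] assms(2), symmetric])
    finally show ?thesis .
  qed
  then have "laplacian w (laplacian w' f) p = (\<Sum>i\<in>UNIV. laplacian w' (pd (w i) (pd (w i) f)) p)"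
    by (simp add: laplacian_def[of w])
  also have "\<dots> = laplacian w' (laplacian w f) p"
    unfolding laplacian_def[of w, abs_def] 
    by (rule laplacian_sum[symmetric, OF op _ assms(2)]) (intro smooth_on_pd assms(1))
  finally show ?thesis .
qed

lemma laplacian_laplacian_funpow_commute:
  fixes f :: "'a::real_normed_vector \<Rightarrow> 'b::real_inner"
  assumes "smooth_on f S" "p \<in> S"
  shows "laplacian w ((laplacian w' ^^ n) f) p = (laplacian w' ^^ n) (laplacian w f) p"
  using assms(2)
proof (induction n arbitrary: p)
  case (Suc n)
  have "laplacian w ((laplacian w' ^^ Suc n) f) p = laplacian w' (laplacian w ((laplacian w' ^^ n) f)) p"
    using laplacian_commute[OF smooth_on_laplacian_funpow[OF assms(1)] Suc.prems] by simp
  also have "\<dots> = (laplacian w' ^^ Suc n) (laplacian w f) p"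
    using laplacian_cong_open[OF smooth_on_open[OF assms(1)] Suc.prems Suc.IH] by simp
  finally show ?case .
qed simp

lemma laplacian_funpow_commute:
  fixes f :: "'a::real_normed_vector \<Rightarrow> 'b::real_inner"
  assumes "smooth_on f S" "p \<in> S"
  shows "(laplacian w ^^ n) ((laplacian w' ^^ n') f) p = (laplacian w' ^^ n') ((laplacian w ^^ n) f) p"
  using assms(2)
proof (induction n arbitrary: p)
  case (Suc n)
  have "(laplacian w ^^ Suc n) ((laplacian w' ^^ n') f) p = laplacian w ((laplacian w' ^^ n') ((laplacian w ^^ n) f)) p"
    using laplacian_cong_open[OF smooth_on_open[OF assms(1)] Suc.prems Suc.IH] by simp
  also have "\<dots> = (laplacian w' ^^ n') ((laplacian w ^^ Suc n) f) p"
    using laplacian_laplacian_funpow_commute[OF smooth_on_laplacian_funpow[OF assms(1)] Suc.prems] by simp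
  finally show ?case .
qed simp


section \<open>The radial part of the Laplace operator\<close>

text \<open>
  For a natural number c this is the Laplace operator in 1 + (c+1) variables on functions that
  depend on the last c+1 of them through their norm only.
\<close>
definition radial_op :: "real \<Rightarrow> (real \<times> real \<Rightarrow> real) \<Rightarrow> real \<times> real \<Rightarrow> real" where
  "radial_op c g q = pd (1, 0) (pd (1, 0) g) q + pd (0, 1) (pd (0, 1) g) q
     + c / snd q * pd (0, 1) g q"

lemma smooth_on_fst: "open S \<Longrightarrow> smooth_on fst S"
  and smooth_on_snd: "open S \<Longrightarrow> smooth_on snd S"
  by (auto intro!: smooth_on_bounded_linear bounded_linear_fst bounded_linear_snd)

lemma pd_snd: "pd v snd p = snd v"
  by (intro pd_bounded_linear bounded_linear_snd)

lemma pd_divide_snd: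
  fixes g :: "real \<times> real \<Rightarrow> real"
  assumes "g differentiable (at q)" "snd q \<noteq> 0"
  shows "pd v (\<lambda>q. g q / snd q) q = pd v g q / snd q - snd v * g q / (snd q)\<^sup>2"
proof -
  have "((\<lambda>q. g q / snd q) has_derivative
      (\<lambda>h. - g q * (inverse (snd q) * snd h * inverse (snd q)) + pd h g q / snd q)) (at q)"
    using assms by (intro has_derivative_divide has_derivative_pd has_derivative_snd has_derivative_ident)
  from has_derivative_imp_pd[OF this, of v] assms(2) show ?thesis
    by (simp add: divide_inverse power2_eq_square algebra_simps)
qed

lemma smooth_on_divide_snd:
  fixes g :: "real \<times> real \<Rightarrow> real"
  assumes "smooth_on g T" "T \<subseteq> {q. snd q > 0}"
  shows "smooth_on (\<lambda>q. g q / snd q) T"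
  using assms by (intro smooth_on_divide smooth_on_snd) (auto simp: smooth_on_open)

text \<open>
  For c = 2 multiplication by r conjugates the operator to the plane Laplacian. For other c the formula is
  applied to a radial derivative g of some function f, when the bracket is the radial derivative of
  the operator with constant c - 2 applied to f.
\<close>
lemma radial_op_divide_snd:
  fixes g :: "real \<times> real \<Rightarrow> real"
  assumes "smooth_on g T" "T \<subseteq> {q. snd q > 0}" "q \<in> T"
  shows "radial_op c (\<lambda>q. g q / snd q) q =
    (pd (1, 0) (pd (1, 0) g) q + pd (0, 1) (pd (0, 1) g) q
      + (c - 2) / snd q * pd (0, 1) g q + (2 - c) / (snd q)\<^sup>2 * g q) / snd q"
proof -
  note op = smooth_on_open[OF assms(1)]
  have pos: "snd q \<noteq> 0" if "q \<in> T" for q using assms(2) that by auto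
  have D: "g differentiable (at q)" "pd v g differentiable (at q)" if "q \<in> T" for q v
    using that assms(1) smooth_on_differentiable smooth_on_pd by blast+
  have D': "(\<lambda>q. g q / snd q) differentiable (at q)" if "q \<in> T" for q
    using smooth_on_divide_snd[OF assms(1,2)] that by (rule smooth_on_differentiable)
  have "pd (1, 0) (pd (1, 0) (\<lambda>q. g q / snd q)) q = pd (1, 0) (\<lambda>q. pd (1, 0) g q / snd q) q"
    by (rule pd_cong_open[OF op assms(3)]) (simp add: pd_divide_snd D pos)
  also have "\<dots> = pd (1, 0) (pd (1, 0) g) q / snd q"
    using assms(3) by (simp add: pd_divide_snd D pos)
  finally have 1: "pd (1, 0) (pd (1, 0) (\<lambda>q. g q / snd q)) q = pd (1, 0) (pd (1, 0) g) q / snd q" .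
  have "pd (0, 1) (pd (0, 1) (\<lambda>q. g q / snd q)) q
      = pd (0, 1) (\<lambda>q. pd (0, 1) g q / snd q - (g q / snd q) / snd q) q"
    by (rule pd_cong_open[OF op assms(3)]) (simp add: pd_divide_snd D pos power2_eq_square)
  also have "\<dots> = pd (0, 1) (\<lambda>q. pd (0, 1) g q / snd q) q - pd (0, 1) (\<lambda>q. (g q / snd q) / snd q) q"
    by (rule pd_diff; rule smooth_on_differentiable[OF _ assms(3)])
      (rule smooth_on_divide_snd[OF smooth_on_pd[OF assms(1)] assms(2)],
       rule smooth_on_divide_snd[OF smooth_on_divide_snd[OF assms(1,2)] assms(2)])
  also have "\<dots> = (pd (0, 1) (pd (0, 1) g) q / snd q - pd (0, 1) g q / (snd q)\<^sup>2)
      - ((pd (0, 1) g q / snd q - g q / (snd q)\<^sup>2) / snd q - (g q / snd q) / (snd q)\<^sup>2)"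
    using assms(3) by (simp only: pd_divide_snd D D' pos snd_conv mult_1 not_False_eq_True)
  also have "\<dots> = pd (0, 1) (pd (0, 1) g) q / snd q - 2 * pd (0, 1) g q / (snd q)\<^sup>2 + 2 * g q / (snd q) ^ 3"
    using pos[OF assms(3)] by (simp add: field_simps power2_eq_square power3_eq_cube)
  finally have 2: "pd (0, 1) (pd (0, 1) (\<lambda>q. g q / snd q)) q = \<dots>" .
  show ?thesis unfolding radial_op_def 1 2
    using pos[OF assms(3)]
    by (simp add: pd_divide_snd D assms(3)) (simp add: field_simps power2_eq_square power3_eq_cube)
qed

text \<open>
  The functions that arise from v/r by repeated application of (1/r) \<partial>_r.
\<close>
primrec radial_iter :: "(real \<times> real \<Rightarrow> real) \<Rightarrow> nat \<Rightarrow> real \<times> real \<Rightarrow> real" where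
  "radial_iter v 0 = (\<lambda>q. v q / snd q)"
| "radial_iter v (Suc j) = (\<lambda>q. pd (0, 1) (radial_iter v j) q / snd q)"

lemma smooth_on_radial_iter:
  assumes "smooth_on v T" "T \<subseteq> {q. snd q > 0}"
  shows "smooth_on (radial_iter v j) T"
proof (induction j)
  case 0
  show ?case unfolding radial_iter.simps by (rule smooth_on_divide_snd[OF assms])
next
  case (Suc j)
  show ?case unfolding radial_iter.simps by (rule smooth_on_divide_snd[OF smooth_on_pd[OF Suc] assms(2)])
qed

text \<open>
  The induction step is the intertwining relation L_(c+2) (1/r) \<partial>_r = (1/r) \<partial>_r L_c: differentiating
  L_c g = 0 with respect to r gives precisely the bracket in radial_op_divide_snd.
\<close>
lemma radial_op_iter:
  assumes v: "smooth_on v T" "T \<subseteq> {q. snd q > 0}"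
    and harm: "\<And>q. q \<in> T \<Longrightarrow> pd (1, 0) (pd (1, 0) v) q + pd (0, 1) (pd (0, 1) v) q = 0"
    and "q \<in> T"
  shows "radial_op (2 * (real j + 1)) (radial_iter v j) q = 0"
  using \<open>q \<in> T\<close>
proof (induction j arbitrary: q)
  case 0
  then show ?case using harm by (simp add: radial_op_divide_snd[OF v])
next
  case (Suc j)
  define g where "g = radial_iter v j"
  define c where "c = 2 * (real j + 1)"
  have g: "smooth_on g T" unfolding g_def by (rule smooth_on_radial_iter[OF v])
  note op = smooth_on_open[OF g]
  have pos: "snd q \<noteq> 0" using v(2) Suc.prems by auto
  have D: "h differentiable (at q)" if "smooth_on h T" for h :: "real \<times> real \<Rightarrow> real"
    using that Suc.prems by (rule smooth_on_differentiable)
  have "pd (0, 1) (radial_op c g) q = pd (0, 1) (\<lambda>q. 0) q"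
    by (rule pd_cong_open[OF op Suc.prems]) (simp only: g_def c_def Suc.IH)
  then have "0 = pd (0, 1) (radial_op c g) q" by simp
  also have "\<dots> = pd (0, 1) (pd (1, 0) (pd (1, 0) g)) q + pd (0, 1) (pd (0, 1) (pd (0, 1) g)) q
      + pd (0, 1) (\<lambda>q. c * (pd (0, 1) g q / snd q)) q"
  proof -
    have s: "smooth_on (pd (1, 0) (pd (1, 0) g)) T" "smooth_on (pd (0, 1) (pd (0, 1) g)) T"
      "smooth_on (\<lambda>q. c * (pd (0, 1) g q / snd q)) T"
      by (rule smooth_on_pd[OF smooth_on_pd[OF g]])+
        (rule smooth_on_mult[OF smooth_on_const[OF op] smooth_on_divide_snd[OF smooth_on_pd[OF g] v(2)]])
    have "radial_op c g = (\<lambda>q. (pd (1, 0) (pd (1, 0) g) q + pd (0, 1) (pd (0, 1) g) q)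
        + c * (pd (0, 1) g q / snd q))"
      by (simp add: radial_op_def fun_eq_iff)
    then show ?thesis
      by (simp only: pd_add[OF D[OF smooth_on_add[OF s(1,2)]] D[OF s(3)]] pd_add[OF D[OF s(1)] D[OF s(2)]])
  qed
  also have "pd (0, 1) (\<lambda>q. c * (pd (0, 1) g q / snd q)) q
      = c * (pd (0, 1) (pd (0, 1) g) q / snd q - pd (0, 1) g q / (snd q)\<^sup>2)"
  proof -
    have "pd (0, 1) (\<lambda>q. c * (pd (0, 1) g q / snd q)) q = c * pd (0, 1) (\<lambda>q. pd (0, 1) g q / snd q) q"
      by (rule pd_bounded_linear_comp[OF bounded_linear_mult_right
            D[OF smooth_on_divide_snd[OF smooth_on_pd[OF g] v(2)]]])
    then show ?thesis using g by (simp add: pd_divide_snd pos D smooth_on_pd)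
  qed
  also have "pd (0, 1) (pd (1, 0) (pd (1, 0) g)) q = pd (1, 0) (pd (1, 0) (pd (0, 1) g)) q"
  proof -
    have "pd (0, 1) (pd (1, 0) (pd (1, 0) g)) q = pd (1, 0) (pd (0, 1) (pd (1, 0) g)) q"
      by (rule pd_commute[OF smooth_on_pd[OF g] Suc.prems])
    also have "\<dots> = pd (1, 0) (pd (1, 0) (pd (0, 1) g)) q"
      by (rule pd_cong_open[OF op Suc.prems]) (rule pd_commute[OF g])
    finally show ?thesis .
  qed
  finally have eq: "pd (1, 0) (pd (1, 0) (pd (0, 1) g)) q + pd (0, 1) (pd (0, 1) (pd (0, 1) g)) q
      + c * (pd (0, 1) (pd (0, 1) g) q / snd q - pd (0, 1) g q / (snd q)\<^sup>2) = 0" by simp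
  have "radial_op (c + 2) (\<lambda>q. pd (0, 1) g q / snd q) q =
      (pd (1, 0) (pd (1, 0) (pd (0, 1) g)) q + pd (0, 1) (pd (0, 1) (pd (0, 1) g)) q
      + c * (pd (0, 1) (pd (0, 1) g) q / snd q - pd (0, 1) g q / (snd q)\<^sup>2)) / snd q"
    unfolding radial_op_divide_snd[OF smooth_on_pd[OF g] v(2) Suc.prems] by (simp add: algebra_simps)
  then have "radial_op (c + 2) (\<lambda>q. pd (0, 1) g q / snd q) q = 0" unfolding eq by simp
  then show ?case by (simp add: g_def c_def algebra_simps)
qed


section \<open>Functions of axial type\<close>

definition axial :: "real \<times> 'a::real_normed_vector \<Rightarrow> real \<times> real" where
  "axial p = (fst p, norm (snd p))"

definition axial_domain :: "(real \<times> real) set \<Rightarrow> (real \<times> 'a::real_normed_vector) set" where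
  "axial_domain T = axial -` T"

text \<open>
  None stands for the direction of the scalar coordinate, so that the scalar and vector terms of the
  operators form a single finite sum.
\<close>
definition axis_dir :: "'m::finite option \<Rightarrow> real \<times> (real, 'm) vec" where
  "axis_dir i = (case i of None \<Rightarrow> (1, 0) | Some j \<Rightarrow> (0, axis j 1))"

lemma sum_UNIV_option: "(\<Sum>i\<in>UNIV. f i) = f None + (\<Sum>j\<in>UNIV. f (Some j))"
  for f :: "'m::finite option \<Rightarrow> 'b::comm_monoid_add"
  by (simp add: UNIV_option_conv sum.reindex)

lemma open_axial_domain: "open T \<Longrightarrow> open (axial_domain T)"
  unfolding axial_domain_def axial_def[abs_def]
  by (rule open_vimage) (auto intro!: continuous_intros)

lemma smooth_on_axial:
  assumes "open T" "T \<subseteq> {q. snd q > 0}"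
  shows "smooth_on (axial :: real \<times> 'a::euclidean_space \<Rightarrow> _) (axial_domain T)"
proof -
  have "snd p \<noteq> 0" if "p \<in> axial_domain T" for p :: "real \<times> 'a"
    using that assms(2) by (auto simp: axial_domain_def axial_def)
  then show ?thesis unfolding axial_def[abs_def]
    by (intro smooth_on_Pair smooth_on_fst smooth_on_norm smooth_on_snd open_axial_domain[OF assms(1)])
qed

lemma pd_axial:
  fixes p :: "real \<times> 'a::euclidean_space"
  assumes "snd p \<noteq> 0"
  shows "pd v axial p = (fst v, (snd p \<bullet> snd v) / norm (snd p))"
proof -
  have "((\<lambda>p. (fst p, norm (snd p))) has_derivative (\<lambda>h. (fst h, sgn (snd p) \<bullet> snd h))) (at p)"
  proof (intro has_derivative_Pair has_derivative_fst has_derivative_ident)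
    from diff_chain_at[OF has_derivative_snd[OF has_derivative_ident] has_derivative_norm[OF assms]]
    show "((\<lambda>p. norm (snd p)) has_derivative (\<lambda>h. sgn (snd p) \<bullet> snd h)) (at p)"
      by (simp add: o_def inner_commute)
  qed
  from has_derivative_imp_pd[OF this, of v]
  show ?thesis by (simp add: axial_def[abs_def] sgn_div_norm divide_inverse mult.commute)
qed

context
  fixes T :: "(real \<times> real) set"
  assumes T: "open T" "T \<subseteq> {q. snd q > 0}"
begin

lemma axial_domain_nonzero: "p \<in> axial_domain T \<Longrightarrow> snd p \<noteq> 0"
  using T(2) by (auto simp: axial_domain_def axial_def)

lemma smooth_on_axial_comp:
  fixes g :: "real \<times> real \<Rightarrow> real"
  assumes "smooth_on g T"
  shows "smooth_on (\<lambda>p :: real \<times> 'a::euclidean_space. g (axial p)) (axial_domain T)"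
  by (rule smooth_on_compose[OF assms smooth_on_axial[OF T]]) (auto simp: axial_domain_def)

lemma smooth_on_snd_comp:
  fixes Q :: "'a::euclidean_space \<Rightarrow> 'b::real_normed_vector"
  assumes "smooth_on Q UNIV"
  shows "smooth_on (\<lambda>p :: real \<times> 'a. Q (snd p)) (axial_domain T)"
  by (rule smooth_on_compose[OF assms smooth_on_snd]) (auto intro: open_axial_domain T)

lemma smooth_on_axial_scaleR:
  fixes g :: "real \<times> real \<Rightarrow> real" and Q :: "'a::euclidean_space \<Rightarrow> 'b::real_normed_vector"
  assumes "smooth_on g T" "smooth_on Q UNIV"
  shows "smooth_on (\<lambda>p. g (axial p) *\<^sub>R Q (snd p)) (axial_domain T)"
  by (intro smooth_on_scaleR smooth_on_axial_comp smooth_on_snd_comp assms)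

lemma pd_axial_scaleR:
  fixes g :: "real \<times> real \<Rightarrow> real" and Q :: "'a::euclidean_space \<Rightarrow> 'b::real_normed_vector"
  assumes g: "smooth_on g T" and Q: "smooth_on Q UNIV" and p: "p \<in> axial_domain T"
  shows "pd v (\<lambda>p. g (axial p) *\<^sub>R Q (snd p)) p =
    (fst v * pd (1, 0) g (axial p) + (snd p \<bullet> snd v) / norm (snd p) * pd (0, 1) g (axial p)) *\<^sub>R Q (snd p)
    + g (axial p) *\<^sub>R pd (snd v) Q (snd p)"
proof -
  have ax: "axial differentiable (at p)" "g differentiable (at (axial p))"
    using smooth_on_differentiable[OF smooth_on_axial[OF T] p] smooth_on_differentiable[OF g] p
    by (auto simp: axial_domain_def)
  have q: "snd differentiable (at p)" "Q differentiable (at (snd p))"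
    using smooth_on_differentiable[OF Q] by (auto intro: bounded_linear_imp_differentiable bounded_linear_snd)
  have "pd v (\<lambda>p. g (axial p) *\<^sub>R Q (snd p)) p =
      pd v (\<lambda>p. g (axial p)) p *\<^sub>R Q (snd p) + g (axial p) *\<^sub>R pd v (\<lambda>p. Q (snd p)) p"
    by (rule pd_scaleR; rule smooth_on_differentiable[OF _ p])
      (intro smooth_on_axial_comp g, intro smooth_on_snd_comp Q)
  also have "pd v (\<lambda>p. Q (snd p)) p = pd (snd v) Q (snd p)"
    by (simp add: pd_chain[OF q] pd_snd)
  also have "pd v (\<lambda>p. g (axial p)) p = pd (fst v, (snd p \<bullet> snd v) / norm (snd p)) g (axial p)"
    by (simp add: pd_chain[OF ax] pd_axial[OF axial_domain_nonzero[OF p]])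
  also have "\<dots> = pd (fst v *\<^sub>R (1, 0) + ((snd p \<bullet> snd v) / norm (snd p)) *\<^sub>R (0, 1)) g (axial p)"
    by simp
  also have "\<dots> = fst v * pd (1, 0) g (axial p) + (snd p \<bullet> snd v) / norm (snd p) * pd (0, 1) g (axial p)"
    unfolding linear_add[OF linear_pd[OF ax(2)]] linear_cmul[OF linear_pd[OF ax(2)]] by simp
  finally show ?thesis .
qed

end

lemma pd_zero_direction [simp]: "pd 0 f p = 0"
  by (simp add: pd_def)

lemma pd_coordinate_expansion:
  fixes Q :: "(real, 'm::finite) vec \<Rightarrow> 'v::real_normed_vector"
  assumes "Q differentiable (at x)"
  shows "pd y Q x = (\<Sum>j\<in>UNIV. (y $ j) *\<^sub>R pd (axis j 1) Q x)"
proof -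
  have "y = (\<Sum>j\<in>UNIV. (y $ j) *\<^sub>R axis j 1)"
    by (simp add: vec_eq_iff axis_def if_distrib cong: if_cong)
  then have "pd y Q x = pd (\<Sum>j\<in>UNIV. (y $ j) *\<^sub>R axis j 1) Q x" by simp
  then show ?thesis
    by (simp only: linear_sum[OF linear_pd[OF assms]] linear_cmul[OF linear_pd[OF assms]])
qed

lemma sum_square_coordinates: "(\<Sum>j\<in>UNIV. (x $ j)\<^sup>2) = (norm x)\<^sup>2" for x :: "(real, 'm::finite) vec"
  unfolding power2_norm_eq_inner by (simp add: inner_vec_def power2_eq_square)

lemma smooth_on_nth: "smooth_on (\<lambda>x :: (real, 'm::finite) vec. x $ j) UNIV"
  by (intro smooth_on_bounded_linear bounded_linear_vec_nth open_UNIV)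

lemma pd_nth: "pd v (\<lambda>x :: (real, 'm::finite) vec. x $ j) x = v $ j"
  by (intro pd_bounded_linear bounded_linear_vec_nth)

text \<open>
  The mixed terms of the product rule contain the Euler derivative of Q twice, which raises the
  constant of the radial operator by 2k; the term with the Laplacian of Q vanishes.
\<close>
lemma laplacian_axial:
  fixes g :: "real \<times> real \<Rightarrow> real" and Q :: "(real, 'm::finite) vec \<Rightarrow> 'v::real_normed_vector"
  assumes T: "open T" "T \<subseteq> {q. snd q > 0}"
    and g: "smooth_on g T" and Q: "smooth_on Q UNIV"
    and harmonic: "\<And>x. (\<Sum>j\<in>UNIV. pd (axis j 1) (pd (axis j 1) Q) x) = 0"
    and euler: "\<And>x. pd x Q x = k *\<^sub>R Q x"
    and p: "p \<in> axial_domain T"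
  shows "laplacian axis_dir (\<lambda>p. g (axial p) *\<^sub>R Q (snd p)) p =
    radial_op (real CARD('m) + 2 * k - 1) g (axial p) *\<^sub>R Q (snd p)"
proof -
  define F where "F p = g (axial p) *\<^sub>R Q (snd p)" for p
  define h where "h q = pd (0, 1) g q / snd q" for q
  define x where "x = snd p"
  define q where "q = axial p"
  define r where "r = norm x"
  note op = open_axial_domain[OF T(1), where 'a="(real, 'm) vec"]
  have h: "smooth_on h T"
    unfolding h_def[abs_def] by (rule smooth_on_divide_snd[OF smooth_on_pd[OF g] T(2)])
  have qT: "q \<in> T" using p by (simp add: q_def axial_domain_def)
  have r: "snd q = r" "r > 0" using T(2) qT by (auto simp: q_def r_def x_def axial_def)
  have "pd (1, 0) (pd (1, 0) F) p = pd (1, 0) (\<lambda>p. pd (1, 0) g (axial p) *\<^sub>R Q (snd p)) p"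
    unfolding F_def[abs_def]
    by (rule pd_cong_open[OF op p]) (simp add: pd_axial_scaleR[OF T g Q])
  also have "\<dots> = pd (1, 0) (pd (1, 0) g) q *\<^sub>R Q x"
    by (simp add: pd_axial_scaleR[OF T smooth_on_pd[OF g] Q p] q_def x_def)
  finally have time: "pd (1, 0) (pd (1, 0) F) p = pd (1, 0) (pd (1, 0) g) q *\<^sub>R Q x" .
  have space: "pd (0, axis j 1) (pd (0, axis j 1) F) p =
      (pd (0, 1) h q / r * (x $ j)\<^sup>2) *\<^sub>R Q x + h q *\<^sub>R Q x
      + (h q *\<^sub>R ((x $ j) *\<^sub>R pd (axis j 1) Q x) + h q *\<^sub>R ((x $ j) *\<^sub>R pd (axis j 1) Q x))
      + g q *\<^sub>R pd (axis j 1) (pd (axis j 1) Q) x" for j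
  proof -
    define e where "e = (axis j 1 :: (real, 'm) vec)"
    define Qj where "Qj x = (x $ j) *\<^sub>R Q x" for x
    have e: "y \<bullet> e = y $ j" for y by (simp add: e_def inner_axis)
    have Qj: "smooth_on Qj UNIV"
      unfolding Qj_def[abs_def] by (rule smooth_on_scaleR[OF smooth_on_nth Q])
    have dQj: "pd e Qj x = Q x + (x $ j) *\<^sub>R pd e Q x"
      unfolding Qj_def[abs_def]
      by (subst pd_scaleR[OF smooth_on_differentiable[OF smooth_on_nth] smooth_on_differentiable[OF Q]])
        (simp_all add: pd_nth e_def)
    have "pd (0, e) (pd (0, e) F) p =
        pd (0, e) (\<lambda>p. h (axial p) *\<^sub>R Qj (snd p) + g (axial p) *\<^sub>R pd e Q (snd p)) p"
      unfolding F_def[abs_def]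
    proof (rule pd_cong_open[OF op p])
      fix p' :: "real \<times> (real, 'm) vec" assume "p' \<in> axial_domain T"
      then show "pd (0, e) (\<lambda>p. g (axial p) *\<^sub>R Q (snd p)) p' =
          h (axial p') *\<^sub>R Qj (snd p') + g (axial p') *\<^sub>R pd e Q (snd p')"
        by (simp add: pd_axial_scaleR[OF T g Q] h_def Qj_def e axial_def[of p', THEN arg_cong[of _ _ snd]]
            mult.commute)
    qed
    also have "\<dots> = pd (0, e) (\<lambda>p. h (axial p) *\<^sub>R Qj (snd p)) p
        + pd (0, e) (\<lambda>p. g (axial p) *\<^sub>R pd e Q (snd p)) p"
      by (rule pd_add; rule smooth_on_differentiable[OF _ p])
        (rule smooth_on_axial_scaleR[OF T h Qj], rule smooth_on_axial_scaleR[OF T g smooth_on_pd[OF Q]])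
    also have "pd (0, e) (\<lambda>p. h (axial p) *\<^sub>R Qj (snd p)) p
        = (x $ j / r * pd (0, 1) h q) *\<^sub>R Qj x + h q *\<^sub>R (Q x + (x $ j) *\<^sub>R pd e Q x)"
      unfolding pd_axial_scaleR[OF T h Qj p] dQj[symmetric] by (simp add: e q_def x_def r_def)
    also have "pd (0, e) (\<lambda>p. g (axial p) *\<^sub>R pd e Q (snd p)) p
        = (x $ j / r * pd (0, 1) g q) *\<^sub>R pd e Q x + g q *\<^sub>R pd e (pd e Q) x"
      unfolding pd_axial_scaleR[OF T g smooth_on_pd[OF Q] p] by (simp add: e q_def x_def r_def)
    also have "x $ j / r * pd (0, 1) g q = h q * x $ j"
      by (simp add: h_def r)
    finally show ?thesis
      unfolding e_def[symmetric] Qj_def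
      by (simp add: algebra_simps power2_eq_square)
  qed
  have "laplacian axis_dir F p = pd (1, 0) (pd (1, 0) g) q *\<^sub>R Q x +
      (\<Sum>j\<in>UNIV. pd (0, axis j 1) (pd (0, axis j 1) F) p)"
    by (simp add: laplacian_def sum_UNIV_option axis_dir_def time)
  also have "(\<Sum>j\<in>UNIV. pd (0, axis j 1) (pd (0, axis j 1) F) p) =
      (pd (0, 1) h q / r * (\<Sum>j\<in>UNIV. (x $ j)\<^sup>2)) *\<^sub>R Q x + real CARD('m) *\<^sub>R (h q *\<^sub>R Q x)
      + (h q *\<^sub>R (\<Sum>j\<in>UNIV. (x $ j) *\<^sub>R pd (axis j 1) Q x)
        + h q *\<^sub>R (\<Sum>j\<in>UNIV. (x $ j) *\<^sub>R pd (axis j 1) Q x))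
      + g q *\<^sub>R (\<Sum>j\<in>UNIV. pd (axis j 1) (pd (axis j 1) Q) x)"
    unfolding space sum.distrib scaleR_sum_right[symmetric] scaleR_sum_left[symmetric]
      sum_distrib_left[symmetric] by (simp add: sum_constant_scaleR)
  also have "(\<Sum>j\<in>UNIV. (x $ j) *\<^sub>R pd (axis j 1) Q x) = k *\<^sub>R Q x"
    using pd_coordinate_expansion[of Q x x] smooth_on_differentiable[OF Q] euler by simp
  also have "(\<Sum>j\<in>UNIV. (x $ j)\<^sup>2) = r * r"
    using sum_square_coordinates[of x] by (simp add: r_def power2_eq_square)
  also have "pd (0, 1) h q / r * (r * r) = pd (0, 1) (pd (0, 1) g) q - pd (0, 1) g q / r"
  proof -
    have "pd (0, 1) h q = pd (0, 1) (pd (0, 1) g) q / r - pd (0, 1) g q / r\<^sup>2"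
      unfolding h_def[abs_def] using r
      by (simp add: pd_divide_snd[OF smooth_on_differentiable[OF smooth_on_pd[OF g] qT]])
    then show ?thesis using r(2) by (simp add: field_simps power2_eq_square)
  qed
  finally have "laplacian axis_dir F p = (pd (1, 0) (pd (1, 0) g) q
      + (pd (0, 1) (pd (0, 1) g) q - pd (0, 1) g q / r + real CARD('m) * h q + (h q * k + h q * k))) *\<^sub>R Q x"
    by (simp only: harmonic scaleR_left_distrib scaleR_scaleR scaleR_zero_right add_0_right)
  also have "pd (1, 0) (pd (1, 0) g) q
      + (pd (0, 1) (pd (0, 1) g) q - pd (0, 1) g q / r + real CARD('m) * h q + (h q * k + h q * k))
      = radial_op (real CARD('m) + 2 * k - 1) g q"
    by (simp add: radial_op_def h_def r(1) algebra_simps diff_divide_distrib add_divide_distrib)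
  finally show ?thesis by (simp only: F_def[abs_def] q_def x_def)
qed


section \<open>Fueter's theorem in one paravector variable\<close>

text \<open>
  Left and right multiplication by the generators both satisfy these relations, so that what is
  proved here holds for the operators on either side.
\<close>
locale clifford_module =
  fixes E :: "'m::finite \<Rightarrow> 'v::euclidean_space \<Rightarrow> 'v"
  assumes bounded_linear_E: "bounded_linear (E j)"
    and anticommute: "E i (E j a) + E j (E i a) = (if i = j then - 2 else 0) *\<^sub>R a"
begin

lemma linear_E: "linear (E j)"
  by (rule bounded_linear.linear[OF bounded_linear_E])

lemmas E_simps = linear_sum[OF linear_E] linear_cmul[OF linear_E] linear_add[OF linear_E]
  linear_0[OF linear_E]

text \<open>
  Against a symmetric array the off-diagonal products cancel in pairs. Both squares used below come
  from this: the square of a vector is minus its squared norm, and the square of the Dirac operator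
  in the vector variable is minus the Laplacian.
\<close>
lemma sum_symmetric:
  assumes "\<And>i j. H i j = H j i"
  shows "(\<Sum>i\<in>UNIV. \<Sum>j\<in>UNIV. E i (E j (H i j))) = - (\<Sum>j\<in>UNIV. H j j)"
proof -
  let ?S = "\<Sum>i\<in>UNIV. \<Sum>j\<in>UNIV. E i (E j (H i j))"
  have "?S = (\<Sum>i\<in>UNIV. \<Sum>j\<in>UNIV. E j (E i (H i j)))"
    by (subst sum.swap) (simp add: assms)
  then have "?S + ?S = (\<Sum>i\<in>UNIV. \<Sum>j\<in>UNIV. E i (E j (H i j)) + E j (E i (H i j)))"
    by (simp add: sum.distrib)
  also have "\<dots> = (\<Sum>i\<in>UNIV. (- 2) *\<^sub>R H i i)"
    by (simp add: anticommute if_distrib[of "\<lambda>c. c *\<^sub>R _"] cong: if_cong)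
  also have "\<dots> = - (2 *\<^sub>R (\<Sum>j\<in>UNIV. H j j))"
    by (simp add: scaleR_sum_right sum_negf)
  finally have "2 *\<^sub>R ?S = 2 *\<^sub>R (- (\<Sum>j\<in>UNIV. H j j))"
    by (simp add: scaleR_2)
  then show ?thesis by (rule scaleR_left_imp_eq[rotated]) simp
qed

lemma E_square: "E j (E j a) = - a"
proof -
  have "2 *\<^sub>R E j (E j a) = 2 *\<^sub>R (- a)" using anticommute[of j j a] by (simp add: scaleR_2)
  then show ?thesis by (rule scaleR_left_imp_eq[rotated]) simp
qed

definition vec_act :: "(real, 'm) vec \<Rightarrow> 'v \<Rightarrow> 'v" where
  "vec_act x a = (\<Sum>i\<in>UNIV. (x $ i) *\<^sub>R E i a)"

lemma vec_act_square: "vec_act x (vec_act x a) = - (norm x)\<^sup>2 *\<^sub>R a"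
proof -
  have "vec_act x (vec_act x a) = (\<Sum>i\<in>UNIV. \<Sum>j\<in>UNIV. E i (E j ((x $ i * x $ j) *\<^sub>R a)))"
    by (simp add: vec_act_def E_simps scaleR_sum_right)
  also have "\<dots> = - (\<Sum>j\<in>UNIV. (x $ j * x $ j) *\<^sub>R a)"
    by (rule sum_symmetric) (simp add: mult.commute)
  also have "\<dots> = - (norm x)\<^sup>2 *\<^sub>R a"
    by (simp add: sum_square_coordinates[unfolded power2_eq_square] power2_eq_square
        flip: scaleR_sum_left)
  finally show ?thesis .
qed

text \<open>
  Moving a generator past the vector x costs -2 times a coordinate of x. When the V j are the partial
  derivatives of a monogenic function, only this correction, an Euler derivative, survives.
\<close>
lemma sum_E_vec_act:
  "(\<Sum>j\<in>UNIV. E j (vec_act x (V j))) =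
    - vec_act x (\<Sum>j\<in>UNIV. E j (V j)) - 2 *\<^sub>R (\<Sum>j\<in>UNIV. (x $ j) *\<^sub>R V j)"
proof -
  have "E j (vec_act x b) + vec_act x (E j b) = (- 2 * x $ j) *\<^sub>R b" for j b
  proof -
    have "E j (vec_act x b) + vec_act x (E j b) = (\<Sum>i\<in>UNIV. (x $ i) *\<^sub>R (E j (E i b) + E i (E j b)))"
      by (simp add: vec_act_def E_simps scaleR_add_right sum.distrib)
    also have "\<dots> = (- 2 * x $ j) *\<^sub>R b"
      by (simp add: anticommute if_distrib[of "\<lambda>c. c *\<^sub>R _"] if_distrib[of "\<lambda>c. _ *\<^sub>R c"] mult.commute cong: if_cong)
    finally show ?thesis .
  qed
  then have "(\<Sum>j\<in>UNIV. E j (vec_act x (V j)) + vec_act x (E j (V j))) =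
      (\<Sum>j\<in>UNIV. (- 2 * x $ j) *\<^sub>R V j)" by simp
  then have "(\<Sum>j\<in>UNIV. E j (vec_act x (V j))) =
      - (2 *\<^sub>R (\<Sum>j\<in>UNIV. (x $ j) *\<^sub>R V j)) - (\<Sum>j\<in>UNIV. vec_act x (E j (V j)))"
    by (simp add: eq_diff_eq sum.distrib scaleR_sum_right sum_negf)
  moreover have "vec_act x (\<Sum>j\<in>UNIV. E j (V j)) = (\<Sum>j\<in>UNIV. vec_act x (E j (V j)))"
    unfolding vec_act_def E_simps scaleR_sum_right by (rule sum.swap)
  ultimately show ?thesis by simp
qed

lemma bounded_linear_vec_act: "bounded_linear (vec_act x)"
  unfolding vec_act_def[abs_def]
  by (intro bounded_linear_sum bounded_linear_const_scaleR bounded_linear_E)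

definition dirac_coeff :: "'m option \<Rightarrow> 'v \<Rightarrow> 'v" where
  "dirac_coeff i a = (case i of None \<Rightarrow> a | Some j \<Rightarrow> E j a)"

lemma bounded_linear_dirac_coeff: "bounded_linear (dirac_coeff i)"
  by (cases i) (simp_all add: dirac_coeff_def[abs_def] bounded_linear_E bounded_linear_ident)

context
  fixes Q :: "(real, 'm) vec \<Rightarrow> 'v"
  assumes Q: "smooth_on Q UNIV"
begin

lemma smooth_on_vec_act: "smooth_on (\<lambda>x. vec_act x (Q x)) UNIV"
  unfolding vec_act_def
  by (intro smooth_on_sum smooth_on_scaleR smooth_on_nth smooth_on_bounded_linear_comp[OF bounded_linear_E]
      Q open_UNIV)

lemma pd_vec_act:
  "pd (axis j 1) (\<lambda>x. vec_act x (Q x)) x = E j (Q x) + vec_act x (pd (axis j 1) Q x)"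
proof -
  have s: "smooth_on (\<lambda>x. E i (Q x)) UNIV" for i
    by (rule smooth_on_bounded_linear_comp[OF bounded_linear_E Q])
  have "pd (axis j 1) (\<lambda>x. vec_act x (Q x)) x =
      (\<Sum>i\<in>UNIV. pd (axis j 1) (\<lambda>x. (x $ i) *\<^sub>R E i (Q x)) x)"
    unfolding vec_act_def by (rule pd_sum_smooth[OF smooth_on_scaleR[OF smooth_on_nth s] UNIV_I])
  also have "\<dots> = (\<Sum>i\<in>UNIV. (axis j 1 $ i) *\<^sub>R E i (Q x) + (x $ i) *\<^sub>R E i (pd (axis j 1) Q x))"
    by (intro sum.cong refl, subst pd_scaleR[OF smooth_on_differentiable[OF smooth_on_nth UNIV_I]
          smooth_on_differentiable[OF s UNIV_I]])
      (simp add: pd_nth pd_bounded_linear_comp[OF bounded_linear_E smooth_on_differentiable[OF Q UNIV_I]])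
  also have "\<dots> = E j (Q x) + vec_act x (pd (axis j 1) Q x)"
    by (simp add: sum.distrib vec_act_def axis_def if_distrib[of "\<lambda>c. c *\<^sub>R _"] cong: if_cong)
  finally show ?thesis .
qed

context
  assumes monogenic: "\<And>x. (\<Sum>j\<in>UNIV. E j (pd (axis j 1) Q x)) = 0"
begin

lemma monogenic_imp_harmonic: "(\<Sum>j\<in>UNIV. pd (axis j 1) (pd (axis j 1) Q) x) = 0"
proof -
  have "(\<Sum>j\<in>UNIV. E j (pd (axis i 1) (pd (axis j 1) Q) x)) = 0" for i
  proof -
    have "pd (axis i 1) (\<lambda>x. \<Sum>j\<in>UNIV. E j (pd (axis j 1) Q x)) x
        = (\<Sum>j\<in>UNIV. pd (axis i 1) (\<lambda>x. E j (pd (axis j 1) Q x)) x)"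
      by (rule pd_sum_smooth[OF smooth_on_bounded_linear_comp[OF bounded_linear_E smooth_on_pd[OF Q]] UNIV_I])
    also have "\<dots> = (\<Sum>j\<in>UNIV. E j (pd (axis i 1) (pd (axis j 1) Q) x))"
      by (intro sum.cong refl pd_bounded_linear_comp[OF bounded_linear_E
            smooth_on_differentiable[OF smooth_on_pd[OF Q] UNIV_I]])
    finally show ?thesis by (simp add: monogenic)
  qed
  then have "0 = (\<Sum>i\<in>UNIV. E i (\<Sum>j\<in>UNIV. E j (pd (axis i 1) (pd (axis j 1) Q) x)))"
    by (simp add: E_simps)
  also have "\<dots> = (\<Sum>i\<in>UNIV. \<Sum>j\<in>UNIV. E i (E j (pd (axis i 1) (pd (axis j 1) Q) x)))"
    by (simp add: E_simps)
  also have "\<dots> = - (\<Sum>j\<in>UNIV. pd (axis j 1) (pd (axis j 1) Q) x)"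
    by (rule sum_symmetric) (rule pd_commute[OF Q UNIV_I])
  finally show ?thesis by simp
qed

text \<open>
  For w = v/r the two coefficients are the two Cauchy-Riemann expressions in u and v (the second
  divided by r), except for a multiple of v/r that is left over in the first one.
\<close>
lemma dirac_axial:
  assumes T: "open T" "T \<subseteq> {q. snd q > 0}" and u: "smooth_on u T" and w: "smooth_on w T"
    and euler: "\<And>x. pd x Q x = k *\<^sub>R Q x"
    and p: "p \<in> axial_domain T"
  shows "dirac axis_dir dirac_coeff
      (\<lambda>p. u (axial p) *\<^sub>R Q (snd p) + w (axial p) *\<^sub>R vec_act (snd p) (Q (snd p))) p =
    (pd (1, 0) u (axial p) - snd (axial p) * pd (0, 1) w (axial p)
        - (real CARD('m) + 2 * k) * w (axial p)) *\<^sub>R Q (snd p)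
    + (pd (1, 0) w (axial p) + pd (0, 1) u (axial p) / snd (axial p)) *\<^sub>R vec_act (snd p) (Q (snd p))"
proof -
  define x where "x = snd p"
  define q where "q = axial p"
  define r where "r = norm x"
  define X where "X = (\<lambda>x. vec_act x (Q x))"
  define F where "F p = u (axial p) *\<^sub>R Q (snd p) + w (axial p) *\<^sub>R X (snd p)" for p
  have r: "snd q = r" "r > 0"
    using T(2) p by (auto simp: q_def r_def x_def axial_def axial_domain_def)
  have X: "smooth_on X UNIV" unfolding X_def by (rule smooth_on_vec_act)
  have pdF: "pd v F p = (fst v * pd (1, 0) u q + (x \<bullet> snd v) / r * pd (0, 1) u q) *\<^sub>R Q x
      + u q *\<^sub>R pd (snd v) Q x
      + ((fst v * pd (1, 0) w q + (x \<bullet> snd v) / r * pd (0, 1) w q) *\<^sub>R X x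
      + w q *\<^sub>R pd (snd v) X x)" for v
  proof -
    have "pd v F p = pd v (\<lambda>p. u (axial p) *\<^sub>R Q (snd p)) p + pd v (\<lambda>p. w (axial p) *\<^sub>R X (snd p)) p"
      unfolding F_def[abs_def]
      by (rule pd_add; rule smooth_on_differentiable[OF _ p])
        (rule smooth_on_axial_scaleR[OF T u Q], rule smooth_on_axial_scaleR[OF T w X])
    then show ?thesis
      by (simp only: pd_axial_scaleR[OF T u Q p] pd_axial_scaleR[OF T w X p] q_def x_def r_def)
  qed
  have space: "E j (pd (0, axis j 1) F p) =
      (pd (0, 1) u q / r) *\<^sub>R ((x $ j) *\<^sub>R E j (Q x)) + u q *\<^sub>R E j (pd (axis j 1) Q x)
      + (pd (0, 1) w q / r) *\<^sub>R ((x $ j) *\<^sub>R E j (X x)) + w q *\<^sub>R E j (vec_act x (pd (axis j 1) Q x))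
      + (- w q) *\<^sub>R Q x" for j
    unfolding pdF fst_conv snd_conv X_def pd_vec_act
    by (simp add: E_simps inner_axis E_square mult.commute scaleR_add_right)
  have "dirac axis_dir dirac_coeff F p = pd (1, 0) F p + (\<Sum>j\<in>UNIV. E j (pd (0, axis j 1) F p))"
    by (simp add: dirac_def sum_UNIV_option axis_dir_def dirac_coeff_def)
  also have "pd (1, 0) F p = pd (1, 0) u q *\<^sub>R Q x + pd (1, 0) w q *\<^sub>R X x"
    by (simp add: pdF)
  also have "(\<Sum>j\<in>UNIV. E j (pd (0, axis j 1) F p)) =
      (pd (0, 1) u q / r) *\<^sub>R vec_act x (Q x) + u q *\<^sub>R (\<Sum>j\<in>UNIV. E j (pd (axis j 1) Q x))
      + (pd (0, 1) w q / r) *\<^sub>R vec_act x (X x)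
      + w q *\<^sub>R (\<Sum>j\<in>UNIV. E j (vec_act x (pd (axis j 1) Q x)))
      + real CARD('m) *\<^sub>R ((- w q) *\<^sub>R Q x)"
    unfolding space sum.distrib scaleR_sum_right[symmetric] vec_act_def[symmetric]
    by (simp add: sum_constant_scaleR)
  also have "(\<Sum>j\<in>UNIV. E j (vec_act x (pd (axis j 1) Q x))) = (- 2 * k) *\<^sub>R Q x"
  proof -
    have "(\<Sum>j\<in>UNIV. (x $ j) *\<^sub>R pd (axis j 1) Q x) = k *\<^sub>R Q x"
      using pd_coordinate_expansion[of Q x x] smooth_on_differentiable[OF Q] euler by simp
    then show ?thesis
      by (simp add: sum_E_vec_act monogenic linear_0[OF bounded_linear.linear[OF bounded_linear_vec_act]])
  qed
  also have "vec_act x (X x) = - (r * r) *\<^sub>R Q x"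
    by (simp add: X_def vec_act_square r_def power2_eq_square)
  finally have "dirac axis_dir dirac_coeff F p =
      (pd (1, 0) u q - r * pd (0, 1) w q - (real CARD('m) + 2 * k) * w q) *\<^sub>R Q x
      + (pd (1, 0) w q + pd (0, 1) u q / r) *\<^sub>R X x"
    using r(2) by (simp add: monogenic X_def algebra_simps)
  then show ?thesis by (simp only: F_def[abs_def] X_def x_def q_def r(1)[unfolded q_def])
qed

text \<open>
  Since the radial operator with constant 2(i+1) annihilates the i-th iterate, only the difference of
  the first-order terms of the two radial operators remains, and it is a multiple of the next iterate.
\<close>
lemma laplacian_funpow_radial_iter:
  assumes T: "open T" "T \<subseteq> {q. snd q > 0}" and v: "smooth_on v T"
    and harm: "\<And>q. q \<in> T \<Longrightarrow> pd (1, 0) (pd (1, 0) v) q + pd (0, 1) (pd (0, 1) v) q = 0"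
    and euler: "\<And>x. pd x Q x = k *\<^sub>R Q x"
    and p: "p \<in> axial_domain T"
  shows "(laplacian axis_dir ^^ i) (\<lambda>p. c *\<^sub>R (radial_iter v 0 (axial p) *\<^sub>R Q (snd p))) p =
    (c * (\<Prod>j<i. real CARD('m) + 2 * k - 1 - 2 * (real j + 1))) *\<^sub>R (radial_iter v i (axial p) *\<^sub>R Q (snd p))"
  using p
proof (induction i arbitrary: p)
  case (Suc i)
  define C where "C = c * (\<Prod>j<i. real CARD('m) + 2 * k - 1 - 2 * (real j + 1))"
  define g where "g = radial_iter v i"
  have g: "smooth_on g T" unfolding g_def by (rule smooth_on_radial_iter[OF v T(2)])
  have axT: "axial p \<in> T" using Suc.prems by (simp add: axial_domain_def)
  have "(laplacian axis_dir ^^ Suc i) (\<lambda>p. c *\<^sub>R (radial_iter v 0 (axial p) *\<^sub>R Q (snd p))) p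
      = laplacian axis_dir (\<lambda>p. C *\<^sub>R (g (axial p) *\<^sub>R Q (snd p))) p"
    using laplacian_cong_open[OF open_axial_domain[OF T(1)] Suc.prems Suc.IH] by (simp add: C_def g_def)
  also have "\<dots> = C *\<^sub>R laplacian axis_dir (\<lambda>p. g (axial p) *\<^sub>R Q (snd p)) p"
    by (rule laplacian_bounded_linear_comp[OF bounded_linear_scaleR_right smooth_on_axial_scaleR[OF T g Q] Suc.prems])
  also have "laplacian axis_dir (\<lambda>p. g (axial p) *\<^sub>R Q (snd p)) p
      = radial_op (real CARD('m) + 2 * k - 1) g (axial p) *\<^sub>R Q (snd p)"
    by (rule laplacian_axial[OF T g Q monogenic_imp_harmonic euler Suc.prems])
  also have "radial_op (real CARD('m) + 2 * k - 1) g (axial p) =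
      radial_op (2 * (real i + 1)) g (axial p)
      + (real CARD('m) + 2 * k - 1 - 2 * (real i + 1)) * radial_iter v (Suc i) (axial p)"
    by (simp add: radial_op_def g_def algebra_simps diff_divide_distrib add_divide_distrib)
  also have "radial_op (2 * (real i + 1)) g (axial p) = 0"
    unfolding g_def by (rule radial_op_iter[OF v T(2) harm axT])
  finally show ?case by (simp add: C_def mult.assoc)
qed simp

text \<open>
  The Dirac operator leaves -2n (v/r) Q, and the n Laplacians contribute the factors
  2n-2, 2n-4, ..., 0. The factor -2n is carried along because for n = 0 there are no others.
\<close>
theorem fueter_one_variable:
  assumes T: "open T" "T \<subseteq> {q. snd q > 0}" and u: "smooth_on u T" and v: "smooth_on v T"
    and CR: "\<And>q. q \<in> T \<Longrightarrow> pd (1, 0) u q = pd (0, 1) v q"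
      "\<And>q. q \<in> T \<Longrightarrow> pd (0, 1) u q = - pd (1, 0) v q"
    and euler: "\<And>x. pd x Q x = k *\<^sub>R Q x"
    and n: "real CARD('m) + 2 * k - 1 = 2 * real n"
    and p: "p \<in> axial_domain T"
  shows "(laplacian axis_dir ^^ n) (dirac axis_dir dirac_coeff
      (\<lambda>p. u (axial p) *\<^sub>R Q (snd p) + v (axial p) *\<^sub>R vec_act (snd p /\<^sub>R norm (snd p)) (Q (snd p)))) p = 0"
proof -
  define w where "w = radial_iter v 0"
  have w: "smooth_on w T" unfolding w_def by (rule smooth_on_radial_iter[OF v T(2)])
  have pos: "snd q > 0" if "q \<in> T" for q using T(2) that by auto
  have D: "v differentiable (at q)" if "q \<in> T" for q by (rule smooth_on_differentiable[OF v that])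
  (* \<omega> = x/r, so v \<omega> Q is also v/r times x Q, where x Q is smooth on the whole space *)
  have scale: "(\<lambda>p. u (axial p) *\<^sub>R Q (snd p) + v (axial p) *\<^sub>R vec_act (snd p /\<^sub>R norm (snd p)) (Q (snd p)))
      = (\<lambda>p. u (axial p) *\<^sub>R Q (snd p) + w (axial p) *\<^sub>R vec_act (snd p) (Q (snd p)))"
    by (simp add: vec_act_def w_def axial_def scaleR_sum_right divide_inverse mult.commute fun_eq_iff mult.left_commute)
  have dirac: "dirac axis_dir dirac_coeff
      (\<lambda>p. u (axial p) *\<^sub>R Q (snd p) + w (axial p) *\<^sub>R vec_act (snd p) (Q (snd p))) p
      = (- 2 * real n) *\<^sub>R (radial_iter v 0 (axial p) *\<^sub>R Q (snd p))"
    if p: "p \<in> axial_domain T" for p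
  proof -
    define q where "q = axial p"
    have q: "q \<in> T" using p by (simp add: q_def axial_domain_def)
    have "pd (0, 1) w q = pd (0, 1) v q / snd q - v q / (snd q)\<^sup>2"
      "pd (1, 0) w q = pd (1, 0) v q / snd q"
      using pos[OF q] by (simp_all add: w_def pd_divide_snd[OF D[OF q]])
    then have "pd (1, 0) u q - snd q * pd (0, 1) w q - (real CARD('m) + 2 * k) * w q
        = - (real CARD('m) + 2 * k - 1) * (v q / snd q)"
      "pd (1, 0) w q + pd (0, 1) u q / snd q = 0"
      using pos[OF q] by (simp_all add: CR[OF q] w_def field_simps power2_eq_square)
    then show ?thesis
      unfolding dirac_axial[OF T u w euler p] n q_def by simp
  qed
  have harm: "pd (1, 0) (pd (1, 0) v) q + pd (0, 1) (pd (0, 1) v) q = 0" if q: "q \<in> T" for q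
  proof -
    have "pd (1, 0) (pd (1, 0) v) q = pd (1, 0) (\<lambda>q. - pd (0, 1) u q) q"
      by (rule pd_cong_open[OF T(1) q]) (simp add: CR)
    also have "\<dots> = - pd (1, 0) (pd (0, 1) u) q"
      by (rule pd_bounded_linear_comp[OF bounded_linear_minus[OF bounded_linear_ident]
            smooth_on_differentiable[OF smooth_on_pd[OF u] q]])
    also have "pd (1, 0) (pd (0, 1) u) q = pd (0, 1) (pd (1, 0) u) q" by (rule pd_commute[OF u q])
    also have "\<dots> = pd (0, 1) (pd (0, 1) v) q"
      by (rule pd_cong_open[OF T(1) q]) (rule CR)
    finally show ?thesis by simp
  qed
  (* the last factor of the product vanishes; for n = 0 the leading one does *)
  have zero: "- 2 * real n * (\<Prod>j<n. 2 * real n - 2 * (real j + 1)) = 0"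
  proof (cases n)
    case (Suc n')
    then show ?thesis by (auto intro!: bexI[of _ n'])
  qed simp
  have "(laplacian axis_dir ^^ n) (dirac axis_dir dirac_coeff
      (\<lambda>p. u (axial p) *\<^sub>R Q (snd p) + w (axial p) *\<^sub>R vec_act (snd p) (Q (snd p)))) p
      = (laplacian axis_dir ^^ n) (\<lambda>p. (- 2 * real n) *\<^sub>R (radial_iter v 0 (axial p) *\<^sub>R Q (snd p))) p"
    by (rule laplacian_funpow_cong_open[OF open_axial_domain[OF T(1)] p dirac])
  also have "\<dots> = (- 2 * real n * (\<Prod>j<n. real CARD('m) + 2 * k - 1 - 2 * (real j + 1))) *\<^sub>R
      (radial_iter v n (axial p) *\<^sub>R Q (snd p))"
    by (rule laplacian_funpow_radial_iter[OF T v harm euler p])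
  also have "\<dots> = 0" unfolding n zero by simp
  finally show ?thesis unfolding scale .
qed

end

end

text \<open>
  In the biregular setting a slice is a sum of two functions as above, the second one with Q
  multiplied from the opposite side. That multiplication is the map B; it commutes with the action
  by associativity, hence preserves monogenicity and homogeneity.
\<close>
lemma fueter_two_terms:
  assumes Q: "smooth_on Q UNIV" and monogenic: "\<And>x. (\<Sum>j\<in>UNIV. E j (pd (axis j 1) Q x)) = 0"
    and B: "bounded_linear B" "\<And>j a. B (E j a) = E j (B a)"
    and T: "open T" "T \<subseteq> {q. snd q > 0}"
    and smooth: "smooth_on u1 T" "smooth_on v1 T" "smooth_on u2 T" "smooth_on v2 T"
    and CR: "\<And>q. q \<in> T \<Longrightarrow> pd (1, 0) u1 q = pd (0, 1) v1 q" "\<And>q. q \<in> T \<Longrightarrow> pd (0, 1) u1 q = - pd (1, 0) v1 q"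
      "\<And>q. q \<in> T \<Longrightarrow> pd (1, 0) u2 q = pd (0, 1) v2 q" "\<And>q. q \<in> T \<Longrightarrow> pd (0, 1) u2 q = - pd (1, 0) v2 q"
    and euler: "\<And>x. pd x Q x = k *\<^sub>R Q x"
    and n: "real CARD('m) + 2 * k - 1 = 2 * real n"
    and p: "p \<in> axial_domain T"
  shows "(laplacian axis_dir ^^ n) (dirac axis_dir dirac_coeff (\<lambda>p.
      (u1 (axial p) *\<^sub>R Q (snd p) + v1 (axial p) *\<^sub>R vec_act (snd p /\<^sub>R norm (snd p)) (Q (snd p))) +
      (u2 (axial p) *\<^sub>R B (Q (snd p)) + v2 (axial p) *\<^sub>R vec_act (snd p /\<^sub>R norm (snd p)) (B (Q (snd p)))))) p = 0"
proof -
  define F1 where "F1 p = u1 (axial p) *\<^sub>R Q (snd p) + v1 (axial p) *\<^sub>R vec_act (snd p /\<^sub>R norm (snd p)) (Q (snd p))" for p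
  define F2 where "F2 p = u2 (axial p) *\<^sub>R B (Q (snd p)) + v2 (axial p) *\<^sub>R vec_act (snd p /\<^sub>R norm (snd p)) (B (Q (snd p)))" for p
  let ?U = "axial_domain T :: (real \<times> (real, 'm) vec) set"
  have BQ: "smooth_on (\<lambda>x. B (Q x)) UNIV" by (rule smooth_on_bounded_linear_comp[OF B(1) Q])
  have dBQ: "pd v (\<lambda>x. B (Q x)) x = B (pd v Q x)" for v x
    by (rule pd_bounded_linear_comp[OF B(1) smooth_on_differentiable[OF Q UNIV_I]])
  have mono': "(\<Sum>j\<in>UNIV. E j (pd (axis j 1) (\<lambda>x. B (Q x)) x)) = 0" for x
  proof -
    have "(\<Sum>j\<in>UNIV. E j (pd (axis j 1) (\<lambda>x. B (Q x)) x)) = B (\<Sum>j\<in>UNIV. E j (pd (axis j 1) Q x))"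
      by (simp add: dBQ B(2) linear_sum[OF bounded_linear.linear[OF B(1)]])
    then show ?thesis by (simp add: monogenic linear_0[OF bounded_linear.linear[OF B(1)]])
  qed
  have euler': "pd x (\<lambda>x. B (Q x)) x = k *\<^sub>R B (Q x)" for x
    by (simp add: dBQ euler linear_cmul[OF bounded_linear.linear[OF B(1)]])
  have smoothF: "smooth_on (\<lambda>p. u (axial p) *\<^sub>R R (snd p) + v (axial p) *\<^sub>R vec_act (snd p /\<^sub>R norm (snd p)) (R (snd p))) ?U"
    if "smooth_on u T" "smooth_on v T" "smooth_on R UNIV" for u v R
  proof -
    have "smooth_on (\<lambda>p. u (axial p) *\<^sub>R R (snd p) + (radial_iter v 0) (axial p) *\<^sub>R vec_act (snd p) (R (snd p))) ?U"
      by (intro smooth_on_add smooth_on_axial_scaleR[OF T that(1,3)]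
          smooth_on_axial_scaleR[OF T smooth_on_radial_iter[OF that(2) T(2)] smooth_on_vec_act[OF that(3)]])
    then show ?thesis
      by (rule smooth_on_cong)
        (simp add: vec_act_def axial_def scaleR_sum_right divide_inverse mult.commute mult.left_commute)
  qed
  have F: "smooth_on F1 ?U" "smooth_on F2 ?U"
    unfolding F1_def[abs_def] F2_def[abs_def]
    by (rule smoothF[OF smooth(1,2) Q], rule smoothF[OF smooth(3,4) BQ])
  have dirac_add: "dirac axis_dir dirac_coeff (\<lambda>p. F1 p + F2 p) p = dirac axis_dir dirac_coeff F1 p + dirac axis_dir dirac_coeff F2 p"
    if "p \<in> ?U" for p
    using F[THEN smooth_on_differentiable[OF _ that]]
    by (simp add: dirac_def pd_add linear_add[OF bounded_linear.linear[OF bounded_linear_dirac_coeff]] sum.distrib)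
  have "(laplacian axis_dir ^^ n) (dirac axis_dir dirac_coeff (\<lambda>p. F1 p + F2 p)) p =
      (laplacian axis_dir ^^ n) (\<lambda>p. dirac axis_dir dirac_coeff F1 p + dirac axis_dir dirac_coeff F2 p) p"
    by (rule laplacian_funpow_cong_open[OF open_axial_domain[OF T(1)] p dirac_add])
  also have "\<dots> = (laplacian axis_dir ^^ n) (dirac axis_dir dirac_coeff F1) p + (laplacian axis_dir ^^ n) (dirac axis_dir dirac_coeff F2) p"
    by (rule laplacian_funpow_add[OF smooth_on_dirac[OF bounded_linear_dirac_coeff F(1)]
          smooth_on_dirac[OF bounded_linear_dirac_coeff F(2)] p])
  also have "(laplacian axis_dir ^^ n) (dirac axis_dir dirac_coeff F1) p = 0"
    unfolding F1_def[abs_def]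
    by (rule fueter_one_variable[OF Q monogenic T smooth(1,2) CR(1,2) euler n p])
  also have "(laplacian axis_dir ^^ n) (dirac axis_dir dirac_coeff F2) p = 0"
    unfolding F2_def[abs_def]
    by (rule fueter_one_variable[OF BQ mono' T smooth(3,4) CR(3,4) euler' n p])
  finally show ?thesis by (simp add: F1_def F2_def)
qed

end


section \<open>The biregular theorem\<close>

text \<open>
  This is the derivative at t = 0 of Q((1+t) x) = (1+t)^k Q(x).
\<close>
lemma homogeneous_imp_euler:
  assumes "\<And>t x. Q (t *\<^sub>R x) = t ^ k *\<^sub>R Q x"
  shows "pd x Q x = real k *\<^sub>R Q x"
proof -
  have "Q (x + t *\<^sub>R x) = (1 + t) ^ k *\<^sub>R Q x" for t
    using assms[of "1 + t" x] by (simp add: algebra_simps)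
  moreover have "((\<lambda>t. (1 + t) ^ k *\<^sub>R Q x) has_vector_derivative real k *\<^sub>R Q x) (at 0)"
    by (auto intro!: derivative_eq_intros)
  ultimately show ?thesis unfolding pd_def by (simp only: vector_derivative_at)
qed

lemma pd_slice_fst: "pd (v, 0) F (s, t) = pd v (\<lambda>s. F (s, t)) s"
  by (simp add: pd_def)

lemma pd_slice_snd: "pd (0, v) F (s, t) = pd v (\<lambda>t. F (s, t)) t"
  by (simp add: pd_def)

lemma laplacian_slice_fst: "(laplacian (\<lambda>i. (w i, 0)) ^^ n) F (s, t) = (laplacian w ^^ n) (\<lambda>s. F (s, t)) s"
  by (induction n arbitrary: s) (auto simp: laplacian_def pd_slice_fst)

lemma laplacian_slice_snd: "(laplacian (\<lambda>i. (0, w i)) ^^ n) F (s, t) = (laplacian w ^^ n) (\<lambda>t. F (s, t)) t"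
  by (induction n arbitrary: t) (auto simp: laplacian_def pd_slice_snd)

lemma dirac_slice_fst: "dirac (\<lambda>i. (w i, 0)) A F (s, t) = dirac w A (\<lambda>s. F (s, t)) s"
  by (simp add: dirac_def pd_slice_fst)

lemma dirac_slice_snd: "dirac (\<lambda>i. (0, w i)) A F (s, t) = dirac w A (\<lambda>t. F (s, t)) t"
  by (simp add: dirac_def pd_slice_snd)

lemma smooth_on_slice_fst:
  fixes f :: "'a::euclidean_space \<times> 'b::euclidean_space \<Rightarrow> 'c::real_normed_vector"
  assumes "smooth_on f S" "open T" "\<And>s. s \<in> T \<Longrightarrow> (s, t) \<in> S"
  shows "smooth_on (\<lambda>s. f (s, t)) T"
  using assms(2,3) by (intro smooth_on_compose[OF assms(1)] smooth_on_Pair smooth_on_const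
      smooth_on_bounded_linear bounded_linear_ident) auto

lemma smooth_on_slice_snd:
  fixes f :: "'a::euclidean_space \<times> 'b::euclidean_space \<Rightarrow> 'c::real_normed_vector"
  assumes "smooth_on f S" "open T" "\<And>t. t \<in> T \<Longrightarrow> (s, t) \<in> S"
  shows "smooth_on (\<lambda>t. f (s, t)) T"
  using assms(2,3) by (intro smooth_on_compose[OF assms(1)] smooth_on_Pair smooth_on_const
      smooth_on_bounded_linear bounded_linear_ident) auto

lemma bounded_bilinear_clmult: "bounded_bilinear (\<odot>)"
  using bilinear_clmult bilinear_conv_bounded_bilinear by blast

interpretation clmult: bounded_bilinear "(\<odot>) :: 'm::{finite,linorder} clifford \<Rightarrow> _"
  by (rule bounded_bilinear_clmult)

lemma clifford_module_left: "clifford_module (\<lambda>j (a :: 'm::{finite,linorder} clifford). gen j \<odot> a)"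
proof (rule clifford_module.intro)
  show "bounded_linear (\<lambda>a :: 'm clifford. gen j \<odot> a)" for j
    by (rule clmult.bounded_linear_right)
  show "gen i \<odot> (gen j \<odot> a) + gen j \<odot> (gen i \<odot> a) = (if i = j then - 2 else 0) *\<^sub>R a"
    for i j and a :: "'m clifford"
    unfolding clmult_assoc[symmetric] clmult.add_left[symmetric] gen_anticommute clmult.scaleR_left
    by (simp add: clmult_one)
qed

lemma clifford_module_right: "clifford_module (\<lambda>j (a :: 'm::{finite,linorder} clifford). a \<odot> gen j)"
proof (rule clifford_module.intro)
  show "bounded_linear (\<lambda>a :: 'm clifford. a \<odot> gen j)" for j
    by (rule clmult.bounded_linear_left)
  show "a \<odot> gen j \<odot> gen i + a \<odot> gen i \<odot> gen j = (if i = j then - 2 else 0) *\<^sub>R a"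
    for i j and a :: "'m clifford"
    unfolding clmult_assoc clmult.add_right[symmetric] gen_anticommute clmult.scaleR_right
    by (auto simp: clmult_one)
qed

interpretation left: clifford_module "\<lambda>j (a :: 'm::{finite,linorder} clifford). gen j \<odot> a"
  by (rule clifford_module_left)

lemma left_vec_act: "left.vec_act x a = clvec x \<odot> a"
  by (simp add: left.vec_act_def clvec_def clmult.sum_left clmult.scaleR_left)

interpretation right: clifford_module "\<lambda>j (a :: 'm::{finite,linorder} clifford). a \<odot> gen j"
  by (rule clifford_module_right)

lemma right_vec_act: "right.vec_act x a = a \<odot> clvec x"
  by (simp add: right.vec_act_def clvec_def clmult.sum_right clmult.scaleR_right)

lemma bounded_linear_clvec: "bounded_linear clvec"
  unfolding clvec_def[abs_def]
  by (intro bounded_linear_sum bounded_linear_scaleR_const bounded_linear_vec_nth)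

abbreviation dir_x :: "'m::finite option \<Rightarrow> 'm point" where "dir_x i \<equiv> (axis_dir i, 0)"
abbreviation dir_y :: "'m::finite option \<Rightarrow> 'm point" where "dir_y i \<equiv> (0, axis_dir i)"

lemma laplace_x_eq: "laplace_x = laplacian dir_x"
  by (auto simp: fun_eq_iff laplace_x_def laplacian_def sum_UNIV_option axis_dir_def zero_prod_def)

lemma laplace_y_eq: "laplace_y = laplacian dir_y"
  by (auto simp: fun_eq_iff laplace_y_def laplacian_def sum_UNIV_option axis_dir_def zero_prod_def)

lemma dirac_x_eq: "dirac_x = dirac dir_x left.dirac_coeff"
  by (auto simp: fun_eq_iff dirac_x_def dirac_def sum_UNIV_option axis_dir_def zero_prod_def left.dirac_coeff_def)

lemma dirac_y_eq: "dirac_y = dirac dir_y right.dirac_coeff"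
  by (auto simp: fun_eq_iff dirac_y_def dirac_def sum_UNIV_option axis_dir_def zero_prod_def right.dirac_coeff_def)

theorem theorem2:
  fixes P :: "(real, 'm) vec \<times> (real, 'm) vec \<Rightarrow> 'm::{finite,linorder} clifford"
    and u1 v1 u2 v2 :: "plane2 \<Rightarrow> real"
    and \<Xi> :: "plane2 set"
    and k l :: nat
  assumes "odd (CARD('m))"
    and "homogeneous_biregular_polynomial k l P"
    and "open \<Xi>"
    and "\<Xi> \<subseteq> {((x1, y1), (x2, y2)). y1 > 0 \<and> y2 > 0}"
    and "C1_on u1 \<Xi>" "C1_on v1 \<Xi>" "C1_on u2 \<Xi>" "C1_on v2 \<Xi>"
    and "cauchy_riemann_1 u1 v1 \<Xi>" "cauchy_riemann_1 u2 v2 \<Xi>"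
    and "cauchy_riemann_2 u1 u2 \<Xi>" "cauchy_riemann_2 v1 v2 \<Xi>"
  shows "biregular_on
    ((laplace_x ^^ (k + (CARD('m) - 1) div 2)) ((laplace_y ^^ (l + (CARD('m) - 1) div 2))
      (\<lambda>((x0, x), (y0, y)).
        let r = norm x; \<rho> = norm y;
            \<omega> = clvec (x /\<^sub>R r); \<nu> = clvec (y /\<^sub>R \<rho>);
            q = ((x0, r), (y0, \<rho>))
        in u1 q *\<^sub>R P (x, y) + v1 q *\<^sub>R (\<omega> \<odot> P (x, y))
           + u2 q *\<^sub>R (P (x, y) \<odot> \<nu>) + v2 q *\<^sub>R (\<omega> \<odot> P (x, y) \<odot> \<nu>))))
    {((x0, x), (y0, y)). ((x0, norm x), (y0, norm y)) \<in> \<Xi>}"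
proof -
  define \<omega> where "\<omega> s = clvec (snd s /\<^sub>R norm (snd s))" for s :: "real \<times> (real, 'm) vec"
  define F where "F = (\<lambda>(s, t). u1 (axial s, axial t) *\<^sub>R P (snd s, snd t)
      + v1 (axial s, axial t) *\<^sub>R (\<omega> s \<odot> P (snd s, snd t))
      + u2 (axial s, axial t) *\<^sub>R (P (snd s, snd t) \<odot> \<omega> t)
      + v2 (axial s, axial t) *\<^sub>R (\<omega> s \<odot> P (snd s, snd t) \<odot> \<omega> t))"
  define \<Omega> :: "'m point set" where "\<Omega> = {(s, t). (axial s, axial t) \<in> \<Xi>}"
  define a where "a = k + (CARD('m) - 1) div 2"
  define b where "b = l + (CARD('m) - 1) div 2"
  have ab: "real CARD('m) + 2 * real k - 1 = 2 * real a" "real CARD('m) + 2 * real l - 1 = 2 * real b"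
    using assms(1) by (auto simp: a_def b_def elim!: oddE)
  have uv: "smooth_on u1 \<Xi>" "smooth_on v1 \<Xi>" "smooth_on u2 \<Xi>" "smooth_on v2 \<Xi>"
    by (rule bicomplex_Cauchy_Riemann_smooth[OF assms(3) assms(5-12)])+
  have P: "smooth_on P UNIV"
    "(\<Sum>j\<in>UNIV. gen j \<odot> pd (axis j 1, 0) P p) = 0"
    "(\<Sum>j\<in>UNIV. pd (0, axis j 1) P p \<odot> gen j) = 0"
    "P (t1 *\<^sub>R x, t2 *\<^sub>R y) = (t1 ^ k * t2 ^ l) *\<^sub>R P (x, y)" for p t1 t2 x y
    using assms(2) smooth_on_polynomial_function[OF _ open_UNIV, of P]
    unfolding homogeneous_biregular_polynomial_def by blast+
  note CR = assms(9-12)[unfolded cauchy_riemann_1_def cauchy_riemann_2_def, rule_format]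

  have half: "snd q > 0" "snd q' > 0" if "(q, q') \<in> \<Xi>" for q q'
    using assms(4) that by auto
  have cont: "continuous_on UNIV (\<lambda>p :: 'm point. (axial (fst p), axial (snd p)))"
    unfolding axial_def by (intro continuous_intros)
  have "open ((\<lambda>p :: 'm point. (axial (fst p), axial (snd p))) -` \<Xi>)"
    by (rule open_vimage[OF assms(3) cont])
  also have "(\<lambda>p :: 'm point. (axial (fst p), axial (snd p))) -` \<Xi> = \<Omega>"
    by (auto simp: \<Omega>_def)
  finally have op: "open \<Omega>" .
  have nz: "snd (fst p) \<noteq> 0" "snd (snd p) \<noteq> 0" if "p \<in> \<Omega>" for p
    using half[of "axial (fst p)" "axial (snd p)"] that by (auto simp: \<Omega>_def axial_def)

  have fst: "smooth_on fst \<Omega>" and snd: "smooth_on snd \<Omega>"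
    by (auto intro!: smooth_on_bounded_linear bounded_linear_fst bounded_linear_snd op)
  have sfst: "smooth_on (\<lambda>p. snd (fst p)) \<Omega>" and ssnd: "smooth_on (\<lambda>p. snd (snd p)) \<Omega>"
    by (rule smooth_on_bounded_linear_comp[OF bounded_linear_snd fst],
        rule smooth_on_bounded_linear_comp[OF bounded_linear_snd snd])
  have ax: "smooth_on (\<lambda>p. (axial (fst p), axial (snd p))) \<Omega>"
  proof -
    have "smooth_on (\<lambda>p. (fst (fst p), norm (snd (fst p)))) \<Omega>" "smooth_on (\<lambda>p. (fst (snd p), norm (snd (snd p)))) \<Omega>"
      using nz by (intro smooth_on_Pair smooth_on_norm sfst ssnd smooth_on_bounded_linear_comp[OF bounded_linear_fst fst]
          smooth_on_bounded_linear_comp[OF bounded_linear_fst snd]; simp)+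
    then show ?thesis unfolding axial_def by (rule smooth_on_Pair)
  qed
  have su: "smooth_on (\<lambda>p. u (axial (fst p), axial (snd p))) \<Omega>" if "smooth_on u \<Xi>" for u :: "plane2 \<Rightarrow> real"
    by (rule smooth_on_compose[OF that ax]) (auto simp: \<Omega>_def)
  have sP: "smooth_on (\<lambda>p. P (snd (fst p), snd (snd p))) \<Omega>"
    by (rule smooth_on_compose[OF P(1) smooth_on_Pair[OF sfst ssnd]]) auto
  have s\<omega>: "smooth_on (\<lambda>p. \<omega> (fst p)) \<Omega>" "smooth_on (\<lambda>p. \<omega> (snd p)) \<Omega>"
    unfolding \<omega>_def
    by (rule smooth_on_bounded_linear_comp[OF bounded_linear_clvec],
        rule smooth_on_scaleR[OF smooth_on_inverse[OF smooth_on_norm[OF sfst]] sfst]; simp add: nz)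
      (rule smooth_on_bounded_linear_comp[OF bounded_linear_clvec],
        rule smooth_on_scaleR[OF smooth_on_inverse[OF smooth_on_norm[OF ssnd]] ssnd]; simp add: nz)
  note mult = smooth_on_bilinear[OF bounded_bilinear_clmult]
  have F: "smooth_on F \<Omega>"
    unfolding F_def case_prod_unfold
    by (intro smooth_on_add smooth_on_scaleR su uv sP mult[OF s\<omega>(1) sP] mult[OF sP s\<omega>(2)]
        mult[OF mult[OF s\<omega>(1) sP] s\<omega>(2)])

  have zero_x: "(laplacian dir_x ^^ a) (dirac dir_x left.dirac_coeff F) p = 0" if "p \<in> \<Omega>" for p
  proof -
    obtain s t where p: "p = (s, t)" by (cases p)
    define T where "T = {q. (q, axial t) \<in> \<Xi>}"
    have "continuous_on UNIV (\<lambda>q. (q, axial t))" by (intro continuous_intros)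
    then have "open T"
      using open_vimage[OF assms(3)] by (simp add: T_def vimage_def)
    moreover have "T \<subseteq> {q. snd q > 0}"
      unfolding T_def by (intro Collect_mono impI half(1))
    ultimately have T: "open T" "T \<subseteq> {q. snd q > 0}" by auto
    have sl: "smooth_on (\<lambda>q. u (q, axial t)) T" if "smooth_on u \<Xi>" for u :: "plane2 \<Rightarrow> real"
      by (rule smooth_on_slice_fst[OF that T(1)]) (simp add: T_def)
    have CRs: "pd (1, 0) (\<lambda>q. u1 (q, axial t)) q = pd (0, 1) (\<lambda>q. v1 (q, axial t)) q"
      "pd (0, 1) (\<lambda>q. u1 (q, axial t)) q = - pd (1, 0) (\<lambda>q. v1 (q, axial t)) q"
      "pd (1, 0) (\<lambda>q. u2 (q, axial t)) q = pd (0, 1) (\<lambda>q. v2 (q, axial t)) q"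
      "pd (0, 1) (\<lambda>q. u2 (q, axial t)) q = - pd (1, 0) (\<lambda>q. v2 (q, axial t)) q" if "q \<in> T" for q
      using CR(1,2)[of "(q, axial t)"] that
      by (simp_all add: T_def zero_prod_def[symmetric] pd_slice_fst)
    (* for fixed y the pairs (u1, v1) and (u2, v2) belong together *)
    have slice: "(\<lambda>s. F (s, t)) = (\<lambda>p.
        (u1 (axial p, axial t) *\<^sub>R P (snd p, snd t)
          + v1 (axial p, axial t) *\<^sub>R left.vec_act (snd p /\<^sub>R norm (snd p)) (P (snd p, snd t))) +
        (u2 (axial p, axial t) *\<^sub>R (P (snd p, snd t) \<odot> \<omega> t)
          + v2 (axial p, axial t) *\<^sub>R left.vec_act (snd p /\<^sub>R norm (snd p)) (P (snd p, snd t) \<odot> \<omega> t)))"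
      by (simp add: F_def left_vec_act \<omega>_def[symmetric] clmult_assoc fun_eq_iff)
    have "(laplacian axis_dir ^^ a) (dirac axis_dir left.dirac_coeff (\<lambda>s. F (s, t))) s = 0"
      unfolding slice
    proof (rule left.fueter_two_terms[OF _ _ _ _ T sl sl sl sl CRs _ ab(1)])
      show "smooth_on (\<lambda>x. P (x, snd t)) UNIV" by (rule smooth_on_slice_fst[OF P(1)]) auto
      show "(\<Sum>j\<in>UNIV. gen j \<odot> pd (axis j 1) (\<lambda>x. P (x, snd t)) x) = 0" for x
        using P(2)[of "(x, snd t)"] by (simp add: pd_slice_fst)
      show "pd x (\<lambda>x. P (x, snd t)) x = real k *\<^sub>R P (x, snd t)" for x
        by (rule homogeneous_imp_euler) (use P(4)[of _ _ 1] in simp)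
      show "s \<in> axial_domain T" using \<open>p \<in> \<Omega>\<close> by (simp add: p \<Omega>_def axial_domain_def T_def)
    qed (use uv in \<open>simp_all add: clmult.bounded_linear_left clmult_assoc\<close>)
    then show ?thesis by (simp add: p laplacian_slice_fst dirac_slice_fst)
  qed

  have zero_y: "(laplacian dir_y ^^ b) (dirac dir_y right.dirac_coeff F) p = 0" if "p \<in> \<Omega>" for p
  proof -
    obtain s t where p: "p = (s, t)" by (cases p)
    define T where "T = {q. (axial s, q) \<in> \<Xi>}"
    have "continuous_on UNIV (\<lambda>q. (axial s, q))" by (intro continuous_intros)
    then have "open T"
      using open_vimage[OF assms(3)] by (simp add: T_def vimage_def)
    moreover have "T \<subseteq> {q. snd q > 0}"
      unfolding T_def by (intro Collect_mono impI half(2))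
    ultimately have T: "open T" "T \<subseteq> {q. snd q > 0}" by auto
    have sl: "smooth_on (\<lambda>q. u (axial s, q)) T" if "smooth_on u \<Xi>" for u :: "plane2 \<Rightarrow> real"
      by (rule smooth_on_slice_snd[OF that T(1)]) (simp add: T_def)
    have CRs: "pd (1, 0) (\<lambda>q. u1 (axial s, q)) q = pd (0, 1) (\<lambda>q. u2 (axial s, q)) q"
      "pd (0, 1) (\<lambda>q. u1 (axial s, q)) q = - pd (1, 0) (\<lambda>q. u2 (axial s, q)) q"
      "pd (1, 0) (\<lambda>q. v1 (axial s, q)) q = pd (0, 1) (\<lambda>q. v2 (axial s, q)) q"
      "pd (0, 1) (\<lambda>q. v1 (axial s, q)) q = - pd (1, 0) (\<lambda>q. v2 (axial s, q)) q" if "q \<in> T" for q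
      using CR(3,4)[of "(axial s, q)"] that
      by (simp_all add: T_def zero_prod_def[symmetric] pd_slice_snd)
    (* for fixed x the pairs are (u1, u2) and (v1, v2) *)
    have slice: "(\<lambda>t. F (s, t)) = (\<lambda>p.
        (u1 (axial s, axial p) *\<^sub>R P (snd s, snd p)
          + u2 (axial s, axial p) *\<^sub>R right.vec_act (snd p /\<^sub>R norm (snd p)) (P (snd s, snd p))) +
        (v1 (axial s, axial p) *\<^sub>R (\<omega> s \<odot> P (snd s, snd p))
          + v2 (axial s, axial p) *\<^sub>R right.vec_act (snd p /\<^sub>R norm (snd p)) (\<omega> s \<odot> P (snd s, snd p))))"
      by (simp add: F_def right_vec_act \<omega>_def[symmetric] fun_eq_iff algebra_simps)
    have "(laplacian axis_dir ^^ b) (dirac axis_dir right.dirac_coeff (\<lambda>t. F (s, t))) t = 0"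
      unfolding slice
    proof (rule right.fueter_two_terms[OF _ _ _ _ T sl sl sl sl CRs _ ab(2)])
      show "smooth_on (\<lambda>y. P (snd s, y)) UNIV" by (rule smooth_on_slice_snd[OF P(1)]) auto
      show "(\<Sum>j\<in>UNIV. pd (axis j 1) (\<lambda>y. P (snd s, y)) y \<odot> gen j) = 0" for y
        using P(3)[of "(snd s, y)"] by (simp add: pd_slice_snd)
      show "pd y (\<lambda>y. P (snd s, y)) y = real l *\<^sub>R P (snd s, y)" for y
        by (rule homogeneous_imp_euler) (use P(4)[of 1] in simp)
      show "t \<in> axial_domain T" using \<open>p \<in> \<Omega>\<close> by (simp add: p \<Omega>_def axial_domain_def T_def)
    qed (use uv in \<open>simp_all add: clmult.bounded_linear_right clmult_assoc\<close>)
    then show ?thesis by (simp add: p laplacian_slice_snd dirac_slice_snd)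
  qed

  define G where "G = (laplacian dir_x ^^ a) ((laplacian dir_y ^^ b) F)"
  have Fb: "smooth_on ((laplacian dir_y ^^ b) F) \<Omega>" by (rule smooth_on_laplacian_funpow[OF F])
  have Dx: "dirac_x G p = 0" if p: "p \<in> \<Omega>" for p
  proof -
    have "dirac_x G p = (laplacian dir_x ^^ a) (dirac dir_x left.dirac_coeff ((laplacian dir_y ^^ b) F)) p"
      unfolding dirac_x_eq G_def by (rule dirac_laplacian_funpow_commute[OF left.bounded_linear_dirac_coeff Fb p])
    also have "\<dots> = (laplacian dir_x ^^ a) ((laplacian dir_y ^^ b) (dirac dir_x left.dirac_coeff F)) p"
      by (rule laplacian_funpow_cong_open[OF op p]) (rule dirac_laplacian_funpow_commute[OF left.bounded_linear_dirac_coeff F])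
    also have "\<dots> = (laplacian dir_y ^^ b) ((laplacian dir_x ^^ a) (dirac dir_x left.dirac_coeff F)) p"
      by (rule laplacian_funpow_commute[OF smooth_on_dirac[OF left.bounded_linear_dirac_coeff F] p])
    also have "\<dots> = (laplacian dir_y ^^ b) (\<lambda>p. 0) p"
      by (rule laplacian_funpow_cong_open[OF op p zero_x])
    finally show ?thesis by simp
  qed
  have Dy: "dirac_y G p = 0" if p: "p \<in> \<Omega>" for p
  proof -
    have "dirac_y G p = (laplacian dir_x ^^ a) (dirac dir_y right.dirac_coeff ((laplacian dir_y ^^ b) F)) p"
      unfolding dirac_y_eq G_def by (rule dirac_laplacian_funpow_commute[OF right.bounded_linear_dirac_coeff Fb p])
    also have "\<dots> = (laplacian dir_x ^^ a) (\<lambda>p. 0) p"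
    proof (rule laplacian_funpow_cong_open[OF op p])
      fix q assume q: "q \<in> \<Omega>"
      have "dirac dir_y right.dirac_coeff ((laplacian dir_y ^^ b) F) q = (laplacian dir_y ^^ b) (dirac dir_y right.dirac_coeff F) q"
        by (rule dirac_laplacian_funpow_commute[OF right.bounded_linear_dirac_coeff F q])
      then show "dirac dir_y right.dirac_coeff ((laplacian dir_y ^^ b) F) q = 0" by (simp add: zero_y[OF q])
    qed
    finally show ?thesis by simp
  qed
  have "C1_on G \<Omega>"
    unfolding G_def by (rule smooth_on_imp_C1_on[OF smooth_on_laplacian_funpow[OF Fb]])
  with op Dx Dy have "biregular_on G \<Omega>" by (simp add: biregular_on_def)
  moreover have "F = (\<lambda>((x0, x), (y0, y)).
        let r = norm x; \<rho> = norm y;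
            \<omega> = clvec (x /\<^sub>R r); \<nu> = clvec (y /\<^sub>R \<rho>);
            q = ((x0, r), (y0, \<rho>))
        in u1 q *\<^sub>R P (x, y) + v1 q *\<^sub>R (\<omega> \<odot> P (x, y))
           + u2 q *\<^sub>R (P (x, y) \<odot> \<nu>) + v2 q *\<^sub>R (\<omega> \<odot> P (x, y) \<odot> \<nu>))"
    by (auto simp: F_def \<omega>_def axial_def Let_def fun_eq_iff)
  moreover have "\<Omega> = {((x0, x), (y0, y)). ((x0, norm x), (y0, norm y)) \<in> \<Xi>}"
    by (auto simp: \<Omega>_def axial_def)
  ultimately show ?thesis
    by (simp only: G_def a_def b_def laplace_x_eq laplace_y_eq)
qed

end
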